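(* Let $m\ge 2$, let $d=\binom{m+1}{2}$, and let $\mathcal{L}$ be the $(2m-1)$-dimensional linear space of $m\times m$ Hankel matrices inside the space $\mathbb{S}^m\simeq\mathbb{R}^d$ of symmetric $m\times m$ matrices. After a linear change of coordinates in $\mathbb{R}^d\simeq\mathbb{S}^m$, the exponential variety $\mathcal{L}^{-1}$ of all inverse Hankel matrices coincides with the affine cone over the Grassmannian $\mathrm{Gr}(2,m+1)$ in its Plücker embedding. In particular, the degree of $\mathcal{L}^{-1}$ in $\mathbb{CP}^{d-1}$ is the Catalan number $\frac1m\binom{2m-2}{m-1}$.
   Context: A Hankel matrix is a matrix of the form $(\theta_{i+j})_{1\le i,j\le m}$. $\mathcal{L}^{-1}$ denotes the Zariski closure of $\{\theta^{-1}:\theta\in\mathcal{L},\ \det\theta\neq0\}$ in the space of symmetric $m\times m$ matrices; it is a cone, and is also regarded as a projective variety in $\mathbb{CP}^{d-1}$. The Grassmannian $\mathrm{Gr}(2,m+1)$ of $2$-dimensional linear subspaces of an $(m+1)$-dimensional space is embedded by the Plücker coordinates $p_{ij}$, $0\le i<j\le m$, in projective space of dimension $\binom{m+1}{2}-1$. *)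

theory Defs
  imports
    "Jordan_Normal_Form.Determinant"
    "HOL-Library.Poly_Mapping"
    "HOL-Library.Function_Algebras"
    "HOL-Computational_Algebra.Polynomial"
    Complex_Main
begin

section \<open>Coordinate spaces\<close>

text \<open>For a finite index set \<open>I\<close>, the space \<open>K\<^sup>I\<close> is realised as the set of functions
  vanishing outside \<open>I\<close>, a subspace of the vector space of all functions.\<close>

definition fun_scale :: "'a::field \<Rightarrow> ('i \<Rightarrow> 'a) \<Rightarrow> 'i \<Rightarrow> 'a" where
  "fun_scale c f = (\<lambda>i. c * f i)"

global_interpretation fun_vs: vector_space "fun_scale :: 'a::field \<Rightarrow> ('i \<Rightarrow> 'a) \<Rightarrow> 'i \<Rightarrow> 'a"
  by unfold_locales (auto simp: fun_scale_def fun_eq_iff algebra_simps)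

definition coord_space :: "'i set \<Rightarrow> ('i \<Rightarrow> 'a::zero) set" where
  "coord_space I = {x. \<forall>i. i \<notin> I \<longrightarrow> x i = 0}"

definition lin_map :: "'i set \<Rightarrow> 'j set \<Rightarrow> ('j \<Rightarrow> 'i \<Rightarrow> 'a::comm_ring_1) \<Rightarrow> ('i \<Rightarrow> 'a) \<Rightarrow> 'j \<Rightarrow> 'a" where
  "lin_map I J T x = (\<lambda>j. if j \<in> J then (\<Sum>i\<in>I. T j i * x i) else 0)"


section \<open>Polynomials, Zariski closure, degree of a projective variety\<close>

text \<open>A polynomial maps monomials (exponent vectors of finite support) to coefficients.\<close>

type_synonym ('i, 'a) mpoly = "('i \<Rightarrow>\<^sub>0 nat) \<Rightarrow>\<^sub>0 'a"

definition eval_mpoly :: "('i, 'a::comm_semiring_1) mpoly \<Rightarrow> ('i \<Rightarrow> 'a) \<Rightarrow> 'a" where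
  "eval_mpoly p x =
     (\<Sum>e\<in>Poly_Mapping.keys p. Poly_Mapping.lookup p e *
        (\<Prod>i\<in>Poly_Mapping.keys e. x i ^ Poly_Mapping.lookup e i))"

definition mpolys :: "'i set \<Rightarrow> ('i, 'a::zero) mpoly set" where
  "mpolys I = {p. \<forall>e\<in>Poly_Mapping.keys p. Poly_Mapping.keys e \<subseteq> I}"

definition forms :: "'i set \<Rightarrow> nat \<Rightarrow> ('i, 'a::zero) mpoly set" where
  "forms I k = {p \<in> mpolys I.
     \<forall>e\<in>Poly_Mapping.keys p. (\<Sum>i\<in>Poly_Mapping.keys e. Poly_Mapping.lookup e i) = k}"

definition zariski_closure :: "'i set \<Rightarrow> ('i \<Rightarrow> 'a::comm_semiring_1) set \<Rightarrow> ('i \<Rightarrow> 'a) set" where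
  "zariski_closure I X = {x \<in> coord_space I.
     \<forall>p \<in> mpolys I. (\<forall>y\<in>X. eval_mpoly p y = 0) \<longrightarrow> eval_mpoly p x = 0}"

text \<open>A projective variety in the projective space of \<open>K\<^sup>I\<close> is given by its affine cone \<open>X\<close>.
  The degree \<open>k\<close> part of its homogeneous coordinate ring is the space of forms of degree \<open>k\<close>
  modulo those vanishing on \<open>X\<close>, that is, the space of restrictions to \<open>X\<close> of forms of
  degree \<open>k\<close>. Restricted functions are extended by 0 outside \<open>X\<close>.\<close>

definition coord_ring_part ::
    "'i set \<Rightarrow> ('i \<Rightarrow> 'a::field) set \<Rightarrow> nat \<Rightarrow> (('i \<Rightarrow> 'a) \<Rightarrow> 'a) set" where
  "coord_ring_part I X k = (\<lambda>p x. if x \<in> X then eval_mpoly p x else 0) ` forms I k"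

definition hilbert_function :: "'i set \<Rightarrow> ('i \<Rightarrow> 'a::field) set \<Rightarrow> nat \<Rightarrow> nat" where
  "hilbert_function I X k = fun_vs.dim (coord_ring_part I X k)"

definition hilbert_polynomial :: "'i set \<Rightarrow> ('i \<Rightarrow> 'a::field) set \<Rightarrow> rat poly" where
  "hilbert_polynomial I X = (THE P. \<forall>\<^sub>F k in sequentially.
      poly P (of_nat k) = of_nat (hilbert_function I X k))"

text \<open>The degree of a projective variety of dimension \<open>n\<close> is \<open>n!\<close> times the leading coefficient
  of its Hilbert polynomial, which has degree \<open>n\<close>.\<close>

definition projective_degree :: "'i set \<Rightarrow> ('i \<Rightarrow> 'a::field) set \<Rightarrow> rat" where
  "projective_degree I X =
     (let P = hilbert_polynomial I X in fact (degree P) * lead_coeff P)"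


section \<open>Hankel matrices and their inverses\<close>

definition sym_mats :: "nat \<Rightarrow> 'a::zero mat set" where
  "sym_mats m = {A \<in> carrier_mat m m. transpose_mat A = A}"

definition hankel_mats :: "nat \<Rightarrow> 'a mat set" where
  "hankel_mats m = {mat m m (\<lambda>(i, j). \<theta> (i + j)) | \<theta> :: nat \<Rightarrow> 'a. True}"

definition sym_index :: "nat \<Rightarrow> (nat \<times> nat) set" where
  "sym_index m = {(i, j). i \<le> j \<and> j < m}"

text \<open>The identification of the symmetric matrices with \<open>K\<^sup>d\<close>: a symmetric matrix is given by its
  entries on and above the diagonal.\<close>

definition sym_coords :: "nat \<Rightarrow> 'a::zero mat \<Rightarrow> nat \<times> nat \<Rightarrow> 'a" where
  "sym_coords m A = (\<lambda>ij. if ij \<in> sym_index m then A $$ ij else 0)"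

definition inverse_mats :: "nat \<Rightarrow> 'a::field mat set \<Rightarrow> 'a mat set" where
  "inverse_mats m L = {B \<in> carrier_mat m m.
     \<exists>A\<in>L. det A \<noteq> 0 \<and> inverts_mat A B \<and> inverts_mat B A}"

text \<open>\<open>inverse_variety m \<L>\<close> is \<open>\<L>\<^sup>-\<^sup>1\<close>, for a linear space \<open>\<L>\<close> of symmetric \<open>m \<times> m\<close> matrices.\<close>

definition inverse_variety :: "nat \<Rightarrow> 'a::field mat set \<Rightarrow> (nat \<times> nat \<Rightarrow> 'a) set" where
  "inverse_variety m L = zariski_closure (sym_index m) (sym_coords m ` inverse_mats m L)"


section \<open>The Grassmannian of 2-dimensional subspaces\<close>

definition grassmannian :: "nat \<Rightarrow> nat \<Rightarrow> (nat \<Rightarrow> 'a::field) set set" where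
  "grassmannian k n = {W. fun_vs.subspace W \<and> W \<subseteq> coord_space {..<n} \<and> fun_vs.dim W = k}"

definition plucker_index :: "nat \<Rightarrow> (nat \<times> nat) set" where
  "plucker_index m = {(i, j). i < j \<and> j \<le> m}"

definition plucker :: "nat \<Rightarrow> (nat \<Rightarrow> 'a::field) \<Rightarrow> (nat \<Rightarrow> 'a) \<Rightarrow> nat \<times> nat \<Rightarrow> 'a" where
  "plucker m u v =
     (\<lambda>(i, j). if (i, j) \<in> plucker_index m then u i * v j - u j * v i else 0)"

text \<open>The line in \<open>K\<^sup>d\<close> that is the image of \<open>W\<close> under the Pluecker embedding; here
  \<open>u, v\<close> runs over the bases of the 2-dimensional space \<open>W\<close>.\<close>

definition plucker_line :: "nat \<Rightarrow> (nat \<Rightarrow> 'a::field) set \<Rightarrow> (nat \<times> nat \<Rightarrow> 'a) set" where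
  "plucker_line m W = {fun_scale c (plucker m u v) | c u v. fun_vs.span {u, v} = W}"

definition grassmannian_cone :: "nat \<Rightarrow> (nat \<times> nat \<Rightarrow> 'a::field) set" where
  "grassmannian_cone m = (\<Union>W \<in> grassmannian 2 (m + 1). plucker_line m W)"


section \<open>Consistency of the conventions\<close>

lemma finite_sym_index: "finite (sym_index m)"
  by (rule finite_subset[of _ "{..<m} \<times> {..<m}"]) (auto simp: sym_index_def)

lemma finite_plucker_index: "finite (plucker_index m)"
  by (rule finite_subset[of _ "{..m} \<times> {..m}"]) (auto simp: plucker_index_def)

lemma card_sym_index: "card (sym_index m) = (m + 1) choose 2"
proof (induction m)
  case 0
  then show ?case by (simp add: sym_index_def)
next
  case (Suc m)
  have "sym_index (Suc m) = sym_index m \<union> (\<lambda>i. (i, m)) ` {..m}"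
    by (auto simp: sym_index_def less_Suc_eq)
  moreover have "sym_index m \<inter> (\<lambda>i. (i, m)) ` {..m} = {}"
    by (auto simp: sym_index_def)
  ultimately have "card (sym_index (Suc m)) = card (sym_index m) + card ((\<lambda>i. (i, m)) ` {..m})"
    by (simp add: card_Un_disjoint finite_sym_index)
  also have "card ((\<lambda>i. (i, m)) ` {..m}) = m + 1"
    by (subst card_image) (auto simp: inj_on_def)
  finally show ?case using Suc by (simp add: numeral_2_eq_2)
qed

lemma card_plucker_index: "card (plucker_index m) = (m + 1) choose 2"
proof -
  have "plucker_index m = (\<lambda>(i, j). (i, Suc j)) ` sym_index m"
  proof (intro equalityI subsetI)
    fix x assume "x \<in> plucker_index m"
    then show "x \<in> (\<lambda>(i, j). (i, Suc j)) ` sym_index m"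
      by (intro image_eqI[of _ _ "(fst x, snd x - 1)"])
         (auto simp: plucker_index_def sym_index_def)
  qed (auto simp: plucker_index_def sym_index_def)
  moreover have "inj_on (\<lambda>(i, j). (i, Suc j)) (sym_index m)"
    by (auto simp: inj_on_def)
  ultimately show ?thesis by (simp add: card_image card_sym_index)
qed

lemma bij_betw_sym_coords:
  "bij_betw (sym_coords m) (sym_mats m :: 'a::zero mat set) (coord_space (sym_index m))"
proof (rule bij_betw_byWitness[where
      f' = "\<lambda>x. mat m m (\<lambda>(i, j). if i \<le> j then x (i, j) else x (j, i))"])
  show "\<forall>A\<in>sym_mats m :: 'a mat set. mat m m (\<lambda>(i, j). if i \<le> j then sym_coords m A (i, j)
          else sym_coords m A (j, i)) = A"
  proof
    fix A :: "'a mat" assume "A \<in> sym_mats m"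
    then have A: "A \<in> carrier_mat m m" "transpose_mat A = A" by (auto simp: sym_mats_def)
    have "A $$ (i, j) = A $$ (j, i)" if "i < m" "j < m" for i j
      using A that by (metis carrier_matD index_transpose_mat(1))
    then show "mat m m (\<lambda>(i, j). if i \<le> j then sym_coords m A (i, j)
          else sym_coords m A (j, i)) = A"
      using A by (intro eq_matI) (auto simp: sym_coords_def sym_index_def)
  qed
qed (auto simp: sym_coords_def sym_index_def sym_mats_def coord_space_def fun_eq_iff
      intro!: eq_matI)

lemma hankel_mats_sym: "hankel_mats m \<subseteq> sym_mats m"
  by (auto simp: hankel_mats_def sym_mats_def add.commute intro!: eq_matI)

lemma inverse_mats_sym:
  assumes "L \<subseteq> sym_mats m" shows "inverse_mats m L \<subseteq> sym_mats m"
proof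
  fix B assume "B \<in> inverse_mats m L"
  then obtain A where A: "A \<in> L" "inverts_mat A B" "inverts_mat B A" and B: "B \<in> carrier_mat m m"
    by (auto simp: inverse_mats_def)
  have A': "A \<in> carrier_mat m m" "transpose_mat A = A" using A assms by (auto simp: sym_mats_def)
  have "transpose_mat B * A = 1\<^sub>m m"
    using A A' B transpose_mult[of A m m B m] by (auto simp: inverts_mat_def)
  moreover have "A * B = 1\<^sub>m m" using A A' by (auto simp: inverts_mat_def)
  moreover have "transpose_mat B * A * B = transpose_mat B * (A * B)"
    using A' B by (intro assoc_mult_mat[of _ m m _ m _ m]) auto
  ultimately have "transpose_mat B = B"
    using B by simp
  then show "B \<in> sym_mats m" using B by (simp add: sym_mats_def)
qed

lemma sum_apply: "(\<Sum>s\<in>S. f s) x = (\<Sum>s\<in>S. f s x)" for f :: "'b \<Rightarrow> 'c \<Rightarrow> 'd::comm_monoid_add"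
  by (induction S rule: infinite_finite_induct) auto

lemma dim_hankel_mats:
  "fun_vs.dim (sym_coords m ` hankel_mats m :: (nat \<times> nat \<Rightarrow> 'a::field) set) = 2 * m - 1"
proof -
  define E :: "nat \<Rightarrow> nat \<times> nat \<Rightarrow> 'a" where
    "E s = (\<lambda>ij. if ij \<in> sym_index m \<and> fst ij + snd ij = s then 1 else 0)" for s
  define pos :: "nat \<Rightarrow> nat \<times> nat" where "pos s = (s div 2, s - s div 2)" for s
  have pos: "pos s \<in> sym_index m" "fst (pos s) + snd (pos s) = s" if "s < 2 * m - 1" for s
    using that by (auto simp: pos_def sym_index_def)
  have E_pos: "E t (pos s) = (if t = s then 1 else 0)" if "s < 2 * m - 1" for s t
    using pos[OF that] by (auto simp: E_def)
  have inj: "inj_on E {..<2 * m - 1}"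
  proof (rule inj_onI)
    fix s t assume st: "s \<in> {..<2 * m - 1}" "t \<in> {..<2 * m - 1}" "E s = E t"
    have "E s (pos s) = E t (pos s)" using st by simp
    then show "s = t" using E_pos[of s s] E_pos[of s t] st(1) by (auto split: if_splits)
  qed
  have sum_E: "(\<Sum>s<2 * m - 1. fun_scale (\<theta> s) (E s)) = sym_coords m (mat m m (\<lambda>(i, j). \<theta> (i + j)))"
    for \<theta> :: "nat \<Rightarrow> 'a"
  proof
    fix ij :: "nat \<times> nat"
    have "(\<Sum>s<2 * m - 1. fun_scale (\<theta> s) (E s)) ij = (\<Sum>s<2 * m - 1. \<theta> s * E s ij)"
      by (simp add: sum_apply fun_scale_def)
    also have "\<dots> = sym_coords m (mat m m (\<lambda>(i, j). \<theta> (i + j))) ij"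
      by (cases ij) (auto simp: E_def sym_coords_def sym_index_def if_distrib[of "(*) _"] cong: if_cong)
    finally show "(\<Sum>s<2 * m - 1. fun_scale (\<theta> s) (E s)) ij
      = sym_coords m (mat m m (\<lambda>(i, j). \<theta> (i + j))) ij" .
  qed
  show ?thesis
  proof (rule fun_vs.dim_unique)
    show "E ` {..<2 * m - 1} \<subseteq> sym_coords m ` hankel_mats m"
    proof (rule image_subsetI)
      fix s
      have "E s = sym_coords m (mat m m (\<lambda>(i, j). if i + j = s then 1 else 0))"
        by (auto simp: E_def sym_coords_def sym_index_def fun_eq_iff)
      moreover have "mat m m (\<lambda>(i, j). if i + j = s then 1 else 0) \<in> (hankel_mats m :: 'a mat set)"
        unfolding hankel_mats_def by (rule CollectI, rule exI[of _ "\<lambda>t. if t = s then 1 else 0"]) simp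
      ultimately show "E s \<in> sym_coords m ` hankel_mats m" by blast
    qed
    show "sym_coords m ` hankel_mats m \<subseteq> fun_vs.span (E ` {..<2 * m - 1})"
    proof
      fix x :: "nat \<times> nat \<Rightarrow> 'a"
      assume "x \<in> sym_coords m ` hankel_mats m"
      then obtain \<theta> where x: "x = sym_coords m (mat m m (\<lambda>(i, j). \<theta> (i + j)))"
        by (auto simp: hankel_mats_def)
      show "x \<in> fun_vs.span (E ` {..<2 * m - 1})"
        unfolding x sum_E[symmetric]
        by (intro fun_vs.span_sum fun_vs.span_scale fun_vs.span_base) auto
    qed
    show "fun_vs.independent (E ` {..<2 * m - 1})"
    proof
      assume "fun_vs.dependent (E ` {..<2 * m - 1})"
      then obtain c s where c: "(\<Sum>v\<in>E ` {..<2 * m - 1}. fun_scale (c v) v) = 0"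
        and s: "s < 2 * m - 1" "c (E s) \<noteq> 0"
        by (auto simp: fun_vs.dependent_finite)
      have "(\<Sum>v\<in>E ` {..<2 * m - 1}. fun_scale (c v) v) = (\<Sum>t<2 * m - 1. fun_scale (c (E t)) (E t))"
        by (subst sum.reindex[OF inj]) (simp add: comp_def)
      with c have "(\<Sum>t<2 * m - 1. fun_scale (c (E t)) (E t)) = 0"
        by simp
      then have "sym_coords m (mat m m (\<lambda>(i, j). c (E (i + j)))) = 0"
        by (simp only: sum_E[of "\<lambda>t. c (E t)"])
      then have "sym_coords m (mat m m (\<lambda>(i, j). c (E (i + j)))) (pos s) = 0" by simp
      moreover have "sym_coords m (mat m m (\<lambda>(i, j). c (E (i + j)))) (pos s) = c (E s)"
        using pos[OF s(1)] by (cases "pos s") (auto simp: sym_coords_def sym_index_def)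
      ultimately show False using s by simp
    qed
    show "card (E ` {..<2 * m - 1}) = 2 * m - 1"
      by (simp only: card_image[OF inj] card_lessThan)
  qed
qed

end

theory Submission
  imports Defs
begin

text \<open>The inverse of a nonsingular Hankel matrix is a Bezoutian: if \<open>B(x, y) = \<Sum> b\<^sub>i\<^sub>j x\<^sup>i y\<^sup>j\<close> is the
  generating polynomial of the inverse, then \<open>(y - x) B(x, y) = u(x) v(y) - u(y) v(x)\<close> for some
  polynomials \<open>u, v\<close> of degree at most \<open>m\<close>; conversely, a nonsingular Bezoutian has a Hankel inverse.
  Multiplication by \<open>y - x\<close> is a linear isomorphism from symmetric to skew-symmetric forms, and it
  carries the Bezoutians to the decomposable skew forms, which are the cone over the Grassmannian.
  Nonsingular Bezoutians are Zariski dense in all Bezoutians, and the Pluecker relations show that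
  the latter form a closed set.

  The homogeneous coordinate ring of the Grassmannian has in degree \<open>k\<close> the basis of standard
  monomials, that is, products of Pluecker coordinates along a chain of \<open>k\<close> index pairs. They span by
  straightening, and they are independent because the leading exponents differ after the substitution
  \<open>u\<^sub>a = t^K\<^sup>m\<^sup>-\<^sup>a\<close>, \<open>v\<^sub>b = t^K\<^sup>m\<^sup>+\<^sup>1\<^sup>+\<^sup>b\<close> with \<open>K\<close> large. Counting chains gives the Hilbert polynomial, with
  leading coefficient \<open>1 / (m! (m - 1)!)\<close> in degree \<open>2m - 2\<close>.\<close>

section \<open>The Bezoutian map\<close>

text \<open>The matrix of multiplication by \<open>y - x\<close>: the coefficient of
  \<open>x^i y^j\<close> in \<open>(y - x) B(x, y)\<close> is
  \<open>b (i, j - 1) - b (i - 1, j)\<close>. For \<open>i < j\<close> both positions lie on or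
  above the diagonal, so the coordinates of a symmetric matrix occur directly. The test
  \<open>0 < i\<close> guards against truncated subtraction.\<close>

definition bez_coeff :: "nat \<times> nat \<Rightarrow> nat \<times> nat \<Rightarrow> 'a::comm_ring_1" where
  "bez_coeff = (\<lambda>(i, j) s. (if s = (i, j - 1) then 1 else 0) - (if 0 < i \<and> s = (i - 1, j) then 1 else 0))"

abbreviation bez_map :: "nat \<Rightarrow> (nat \<times> nat \<Rightarrow> 'a::comm_ring_1) \<Rightarrow> nat \<times> nat \<Rightarrow> 'a" where
  "bez_map m \<equiv> lin_map (sym_index m) (plucker_index m) bez_coeff"

text \<open>Division by \<open>y - x\<close>: the relation
  \<open>b (i, j) = y (i, j + 1) + b (i - 1, j + 1)\<close> is unrolled along the antidiagonal until
  the first index is 0.\<close>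

definition bez_inv :: "nat \<Rightarrow> (nat \<times> nat \<Rightarrow> 'a::comm_ring_1) \<Rightarrow> nat \<times> nat \<Rightarrow> 'a" where
  "bez_inv m y = (\<lambda>(i, j). if (i, j) \<in> sym_index m then \<Sum>l\<le>i. y (i - l, j + 1 + l) else 0)"

lemma mem_sym_index: "(i, j) \<in> sym_index m \<longleftrightarrow> i \<le> j \<and> j < m"
  by (simp add: sym_index_def)

lemma mem_plucker_index: "(i, j) \<in> plucker_index m \<longleftrightarrow> i < j \<and> j \<le> m"
  by (simp add: plucker_index_def)

lemma coord_space_zero: "x \<in> coord_space I \<Longrightarrow> i \<notin> I \<Longrightarrow> x i = 0"
  by (auto simp: coord_space_def)

lemma bez_map_apply:
  assumes "x \<in> coord_space (sym_index m)" "(i, j) \<in> plucker_index m"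
  shows "bez_map m x (i, j) = x (i, j - 1) - (if i = 0 then 0 else x (i - 1, j))"
proof -
  have "bez_map m x (i, j) = (\<Sum>s\<in>sym_index m. (if s = (i, j - 1) then x s else 0)
      - (if s = (i - 1, j) then (if 0 < i then x s else 0) else 0))"
    using assms(2) by (auto simp: lin_map_def bez_coeff_def algebra_simps intro!: sum.cong)
  also have "\<dots> = x (i, j - 1) - (if i = 0 then 0 else x (i - 1, j))"
    using assms finite_sym_index[of m]
    by (auto simp: sum_subtractf sum.delta coord_space_zero)
  finally show ?thesis .
qed

lemma bez_map_outside: "q \<notin> plucker_index m \<Longrightarrow> bez_map m x q = 0"
  by (simp add: lin_map_def)

lemma plucker_coord_space: "plucker m u v \<in> coord_space (plucker_index m)"
  by (auto simp: plucker_def coord_space_def)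

lemma bez_map_coord_space: "bez_map m x \<in> coord_space (plucker_index m)"
  by (simp add: coord_space_def bez_map_outside)

lemma bez_inv_coord_space: "bez_inv m y \<in> coord_space (sym_index m)"
  by (auto simp: coord_space_def bez_inv_def)

lemma bez_inv_bez_map:
  assumes "x \<in> coord_space (sym_index m)"
  shows "bez_inv m (bez_map m x) = x"
proof
  fix s :: "nat \<times> nat"
  obtain i j where s: "s = (i, j)" by (cases s)
  \<comment> \<open>The sum telescopes. The claim also covers \<open>j\<close> beyond the range,
    where both sides vanish, since the induction on \<open>i\<close> raises
    \<open>j\<close>.\<close>
  have *: "(\<Sum>l\<le>i. bez_map m x (i - l, j + 1 + l)) = x (i, j)" if "i \<le> j" for i j
    using that
  proof (induction i arbitrary: j)
    case 0
    show ?case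
    proof (cases "j < m")
      case True
      then show ?thesis by (simp add: bez_map_apply[OF assms] mem_plucker_index)
    next
      case False
      then show ?thesis
        using assms by (simp add: bez_map_outside mem_plucker_index coord_space_def mem_sym_index)
    qed
  next
    case (Suc i)
    have "(\<Sum>l\<le>Suc i. bez_map m x (Suc i - l, j + 1 + l))
        = bez_map m x (Suc i, Suc j) + (\<Sum>l\<le>i. bez_map m x (i - l, Suc j + 1 + l))"
      by (simp only: sum.atMost_Suc_shift) simp
    also have "\<dots> = bez_map m x (Suc i, Suc j) + x (i, Suc j)"
      using Suc.IH[of "Suc j"] Suc.prems by simp
    also have "\<dots> = x (Suc i, j)"
    proof (cases "j < m")
      case True
      then show ?thesis using Suc by (simp add: bez_map_apply[OF assms] mem_plucker_index)
    next
      case False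
      then show ?thesis
        using assms by (simp add: bez_map_outside mem_plucker_index coord_space_def mem_sym_index)
    qed
    finally show ?case .
  qed
  show "bez_inv m (bez_map m x) s = x s"
  proof (cases "s \<in> sym_index m")
    case True
    then show ?thesis using * s by (simp add: bez_inv_def mem_sym_index)
  next
    case False
    then show ?thesis using assms s by (simp add: bez_inv_def coord_space_zero)
  qed
qed

lemma bez_map_bez_inv:
  assumes y: "y \<in> coord_space (plucker_index m)"
  shows "bez_map m (bez_inv m y) = y"
proof
  fix q :: "nat \<times> nat"
  obtain i j where q: "q = (i, j)" by (cases q)
  show "bez_map m (bez_inv m y) q = y q"
  proof (cases "q \<in> plucker_index m")
    case False
    then show ?thesis using y by (simp add: bez_map_outside coord_space_zero)
  next
    case True
    then have ij: "i < j" "j \<le> m" "i \<le> j - 1" "j - 1 < m" using q by (auto simp: mem_plucker_index)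
    have "bez_inv m y (i, j - 1) = (\<Sum>l\<le>i. y (i - l, j + l))"
      using ij by (simp add: bez_inv_def mem_sym_index)
    \<comment> \<open>For \<open>j = m\<close> the index \<open>(i - 1, m)\<close> is not a matrix
      position, and the sum is 0 because \<open>y\<close> vanishes beyond column
      \<open>m\<close>.\<close>
    moreover have "bez_inv m y (i - 1, j) = (\<Sum>l\<le>i - 1. y (i - 1 - l, j + 1 + l))" if "0 < i"
    proof (cases "j < m")
      case True
      then show ?thesis using ij by (auto simp: bez_inv_def mem_sym_index)
    next
      case False
      then have "y (i - 1 - l, j + 1 + l) = 0" for l
        using y by (auto simp: coord_space_def mem_plucker_index)
      with False show ?thesis by (simp add: bez_inv_def mem_sym_index)
    qed
    \<comment> \<open>The two antidiagonal sums differ exactly in the first term of the longer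
      one.\<close>
    moreover have "(\<Sum>l\<le>i. y (i - l, j + l)) = y (i, j) + (\<Sum>l\<le>i - 1. y (i - 1 - l, j + 1 + l))"
      if i: "0 < i"
    proof -
      obtain i' where i': "i = Suc i'" using gr0_implies_Suc[OF i] by blast
      show ?thesis unfolding i' by (simp only: sum.atMost_Suc_shift) simp
    qed
    ultimately show ?thesis
      using True q bez_map_apply[OF bez_inv_coord_space, of i j m y] by auto
  qed
qed

lemma bij_betw_bez_map:
  "bij_betw (bez_map m) (coord_space (sym_index m)) (coord_space (plucker_index m))"
  by (rule bij_betw_byWitness[where f' = "bez_inv m"])
     (auto simp: bez_inv_bez_map bez_map_bez_inv bez_inv_coord_space bez_map_coord_space)

section \<open>The displacement of a symmetric matrix\<close>

definition sym_entry :: "(nat \<times> nat \<Rightarrow> 'a) \<Rightarrow> nat \<Rightarrow> nat \<Rightarrow> 'a" where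
  "sym_entry x i j = (if i \<le> j then x (i, j) else x (j, i))"

text \<open>All coefficients of \<open>(y - x) B(x, y)\<close>, as a skew matrix to be read for
  indices 0 to \<open>m\<close>. Unlike the coordinates above the diagonal, it allows sums over full
  rows and columns.\<close>

definition disp :: "(nat \<times> nat \<Rightarrow> 'a::comm_ring_1) \<Rightarrow> nat \<Rightarrow> nat \<Rightarrow> 'a" where
  "disp x i j = (if j = 0 then 0 else sym_entry x i (j - 1)) - (if i = 0 then 0 else sym_entry x (i - 1) j)"

lemma sym_entry_commute: "sym_entry x i j = sym_entry x j i"
  by (simp add: sym_entry_def)

lemma disp_skew: "disp x j i = - disp x i j"
  by (simp add: disp_def sym_entry_commute)

lemma disp_diag: "disp x i i = 0"
  by (simp add: disp_def sym_entry_commute)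

lemma bez_map_disp:
  assumes "x \<in> coord_space (sym_index m)" "(i, j) \<in> plucker_index m"
  shows "bez_map m x (i, j) = disp x i j"
  using assms(2) by (auto simp: bez_map_apply[OF assms] disp_def sym_entry_def mem_plucker_index)

lemma bez_map_eq_plucker_iff:
  assumes "x \<in> coord_space (sym_index m)"
  shows "bez_map m x = plucker m u v \<longleftrightarrow> (\<forall>i\<le>m. \<forall>j\<le>m. disp x i j = u i * v j - u j * v i)"
    (is "?L \<longleftrightarrow> ?R")
proof
  assume L: ?L
  have *: "disp x i j = u i * v j - u j * v i" if "i < j" "j \<le> m" for i j
    using fun_cong[OF L, of "(i, j)"] bez_map_disp[OF assms, of i j] that
    by (simp add: plucker_def mem_plucker_index)
  show ?R
  proof (intro allI impI)
    fix i j assume "i \<le> m" "j \<le> m"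
    then consider "i < j" | "i = j" | "j < i" by linarith
    then show "disp x i j = u i * v j - u j * v i"
    proof cases
      case 3
      then show ?thesis using *[of j i] disp_skew[of x i j] \<open>i \<le> m\<close> by (simp add: algebra_simps)
    qed (use * \<open>j \<le> m\<close> in \<open>auto simp: disp_diag\<close>)
  qed
next
  assume R: ?R
  show ?L
  proof
    fix q :: "nat \<times> nat"
    show "bez_map m x q = plucker m u v q"
      using R bez_map_disp[OF assms] by (cases q) (auto simp: plucker_def bez_map_outside mem_plucker_index)
  qed
qed

text \<open>Over a field the three-term Pluecker relations characterise decomposable skew forms: if
  the entry at \<open>(a, b)\<close> is nonzero, then column \<open>b\<close> divided by that entry
  and row \<open>a\<close> are the two factors.\<close>

lemma bez_map_decomposableI:
  fixes x :: "nat \<times> nat \<Rightarrow> 'a::field"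
  assumes x: "x \<in> coord_space (sym_index m)"
    and rel: "\<And>a b c d. a \<le> m \<Longrightarrow> b \<le> m \<Longrightarrow> c \<le> m \<Longrightarrow> d \<le> m \<Longrightarrow>
      disp x a b * disp x c d - disp x a c * disp x b d + disp x a d * disp x b c = 0"
  shows "\<exists>u v. bez_map m x = plucker m u v"
proof (cases "\<exists>a\<le>m. \<exists>b\<le>m. disp x a b \<noteq> 0")
  case False
  then have "bez_map m x = plucker m (\<lambda>_. 0) (\<lambda>_. 0)"
    by (simp add: bez_map_eq_plucker_iff[OF x])
  then show ?thesis by blast
next
  case True
  then obtain a b where ab: "a \<le> m" "b \<le> m" "disp x a b \<noteq> 0" by blast
  \<comment> \<open>This is the relation for \<open>a, b, i, j\<close>, solved for
    \<open>disp x i j\<close>.\<close>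
  have "disp x i j = disp x i b / disp x a b * disp x a j - disp x j b / disp x a b * disp x a i"
    if "i \<le> m" "j \<le> m" for i j
    using rel[OF ab(1,2) that] ab(3) disp_skew[of x b i] disp_skew[of x b j]
    by (simp add: field_simps)
  then have "bez_map m x = plucker m (\<lambda>i. disp x i b / disp x a b) (disp x a)"
    by (simp add: bez_map_eq_plucker_iff[OF x])
  then show ?thesis by blast
qed

lemma disp_plucker_relation:
  assumes "x \<in> coord_space (sym_index m)" "bez_map m x = plucker m u v"
    "a \<le> m" "b \<le> m" "c \<le> m" "d \<le> m"
  shows "disp x a b * disp x c d - disp x a c * disp x b d + disp x a d * disp x b c = 0"
proof -
  have "disp x i j = u i * v j - u j * v i" if "i \<le> m" "j \<le> m" for i j
    using assms(2) that by (simp add: bez_map_eq_plucker_iff[OF assms(1)])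
  note this[OF assms(3,4)] this[OF assms(5,6)] this[OF assms(3,5)] this[OF assms(4,6)]
    this[OF assms(3,6)] this[OF assms(4,5)]
  then show ?thesis by (simp only:) (simp add: algebra_simps)
qed

section \<open>Inverses of Hankel matrices are Bezoutians\<close>

lemma sym_entry_sym_coords:
  assumes "B \<in> sym_mats m" "i < m" "j < m"
  shows "sym_entry (sym_coords m B) i j = B $$ (i, j)"
proof -
  have "B $$ (i, j) = B $$ (j, i)"
    using assms index_transpose_mat(1)[of i B j] by (auto simp: sym_mats_def)
  then show ?thesis using assms by (auto simp: sym_entry_def sym_coords_def mem_sym_index)
qed

lemma sym_coords_coord_space: "sym_coords m B \<in> coord_space (sym_index m)"
  by (simp add: sym_coords_def coord_space_def)

lemma sym_entry_outside:
  assumes "x \<in> coord_space (sym_index m)" "m \<le> i \<or> m \<le> j"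
  shows "sym_entry x i j = 0"
  using assms by (auto simp: sym_entry_def coord_space_def mem_sym_index)

lemma inverse_mats_entries:
  assumes "A \<in> carrier_mat m m" "B \<in> carrier_mat m m" "inverts_mat A B" "i < m" "j < m"
  shows "(\<Sum>k<m. A $$ (i, k) * B $$ (k, j)) = (if i = j then 1 else 0)"
proof -
  have "(A * B) $$ (i, j) = (1\<^sub>m m) $$ (i, j)"
    using assms by (simp add: inverts_mat_def)
  then show ?thesis
    using assms by (simp add: scalar_prod_def atLeast0LessThan)
qed

text \<open>For \<open>A = (\<theta>\<^bsub>k+l\<^esub>)\<close> and \<open>B = A\<^sup>-\<^sup>1\<close>, evaluating \<open>\<Sum>\<^sub>k\<^sub>,\<^sub>l B\<^sub>i\<^sub>k \<theta>\<^bsub>k+l+1\<^esub> B\<^sub>l\<^sub>j\<close> in the two possible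
  orders gives the displacement identity for \<open>B\<close>.\<close>

lemma inverse_hankel_decomposable:
  fixes B :: "'a::field mat"
  assumes m: "0 < m" and "B \<in> inverse_mats m (hankel_mats m)"
  shows "\<exists>u v. bez_map m (sym_coords m B) = plucker m u v"
proof -
  obtain A where A: "A \<in> hankel_mats m" "inverts_mat A B" "inverts_mat B A" and B: "B \<in> carrier_mat m m"
    using assms by (auto simp: inverse_mats_def)
  then obtain \<theta> where \<theta>: "A = mat m m (\<lambda>(i, j). \<theta> (i + j))" by (auto simp: hankel_mats_def)
  have Ac: "A \<in> carrier_mat m m" by (simp add: \<theta>)
  have Bs: "B \<in> sym_mats m" using assms inverse_mats_sym[OF hankel_mats_sym] by blast
  have Bsym: "B $$ (i, j) = B $$ (j, i)" if "i < m" "j < m" for i j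
    using sym_entry_sym_coords[OF Bs that] sym_entry_sym_coords[OF Bs that(2,1)]
    by (simp add: sym_entry_commute)
  \<comment> \<open>Up to sign, \<open>u\<close> is a monic polynomial of degree \<open>m\<close>,
    and \<open>v\<close> is the last column of \<open>B\<close>. The value
    \<open>\<theta> (2 * m - 1)\<close> used in \<open>a\<close> does not occur in \<open>A\<close>;
    altering it adds a multiple of \<open>v\<close> to \<open>u\<close>, which leaves the minors
    unchanged.\<close>
  define a where "a i = (\<Sum>k<m. B $$ (i, k) * \<theta> (k + m))" for i
  define u where "u i = (if i < m then a i else - 1)" for i
  define v where "v i = (if i < m then B $$ (i, m - 1) else 0)" for i
  let ?x = "sym_coords m B"
  obtain n where n: "m = Suc n" using m by (cases m) auto
  have AB: "(\<Sum>l<m. \<theta> (k + l) * B $$ (l, j)) = (if k = j then 1 else 0)" if "k < m" "j < m" for k j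
    using inverse_mats_entries[OF Ac B A(2) that] that by (simp add: \<theta>)
  have BA: "(\<Sum>k<m. B $$ (i, k) * \<theta> (k + l)) = (if i = l then 1 else 0)" if "i < m" "l < m" for i l
    using inverse_mats_entries[OF B Ac A(3) that] that by (simp add: \<theta>)
  have aj: "(\<Sum>l<m. \<theta> (n + l + 1) * B $$ (l, j)) = a j" if "j < m" for j
    unfolding a_def using that Bsym by (intro sum.cong) (auto simp: n add.commute mult.commute)
  have ai: "(\<Sum>k<m. B $$ (i, k) * \<theta> (k + n + 1)) = a i" for i
    unfolding a_def by (simp add: n)
  have main: "(if j = 0 then 0 else B $$ (i, j - 1)) - (if i = 0 then 0 else B $$ (i - 1, j))
      = a i * B $$ (n, j) - B $$ (i, n) * a j" if i: "i < m" and j: "j < m" for i j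
  proof -
    \<comment> \<open>For \<open>k < n\<close> the inner sum is an entry of row \<open>k + 1\<close>
      of \<open>A * B = 1\<close>; for \<open>k = n\<close> it leaves the matrix and equals
      \<open>a j\<close>.\<close>
    have "(\<Sum>k<m. B $$ (i, k) * (\<Sum>l<m. \<theta> (k + l + 1) * B $$ (l, j)))
        = (\<Sum>k<n. B $$ (i, k) * (\<Sum>l<m. \<theta> (k + 1 + l) * B $$ (l, j))) + B $$ (i, n) * a j"
      using aj[OF j] by (simp add: n ac_simps)
    also have "(\<Sum>k<n. B $$ (i, k) * (\<Sum>l<m. \<theta> (k + 1 + l) * B $$ (l, j)))
        = (\<Sum>k<n. if k = j - 1 then (if j = 0 then 0 else B $$ (i, k)) else 0)"
      by (rule sum.cong[OF refl], subst AB) (use j n in auto)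
    also have "\<dots> = (if j = 0 then 0 else B $$ (i, j - 1))" using j n by auto
    finally have 1: "(\<Sum>k<m. B $$ (i, k) * (\<Sum>l<m. \<theta> (k + l + 1) * B $$ (l, j)))
        = (if j = 0 then 0 else B $$ (i, j - 1)) + B $$ (i, n) * a j" .
    have "(\<Sum>l<m. (\<Sum>k<m. B $$ (i, k) * \<theta> (k + l + 1)) * B $$ (l, j))
        = (\<Sum>l<n. (\<Sum>k<m. B $$ (i, k) * \<theta> (k + (l + 1))) * B $$ (l, j)) + a i * B $$ (n, j)"
      using ai[of i] by (simp add: n ac_simps)
    also have "(\<Sum>l<n. (\<Sum>k<m. B $$ (i, k) * \<theta> (k + (l + 1))) * B $$ (l, j))
        = (\<Sum>l<n. if l = i - 1 then (if i = 0 then 0 else B $$ (l, j)) else 0)"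
      by (rule sum.cong[OF refl], subst BA) (use i n in auto)
    also have "\<dots> = (if i = 0 then 0 else B $$ (i - 1, j))" using i n by auto
    finally have 2: "(\<Sum>l<m. (\<Sum>k<m. B $$ (i, k) * \<theta> (k + l + 1)) * B $$ (l, j))
        = (if i = 0 then 0 else B $$ (i - 1, j)) + a i * B $$ (n, j)" .
    have "(\<Sum>k<m. B $$ (i, k) * (\<Sum>l<m. \<theta> (k + l + 1) * B $$ (l, j)))
        = (\<Sum>l<m. (\<Sum>k<m. B $$ (i, k) * \<theta> (k + l + 1)) * B $$ (l, j))"
      by (simp only: sum_distrib_left sum_distrib_right mult.assoc) (rule sum.swap)
    with 1 2 show ?thesis by (simp add: algebra_simps)
  qed
  have ent: "sym_entry ?x i j = (if i < m \<and> j < m then B $$ (i, j) else 0)" for i j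
    using sym_entry_sym_coords[OF Bs, of i j] sym_entry_outside[OF sym_coords_coord_space, of m i j]
    by auto
  \<comment> \<open>Index \<open>m\<close> lies outside \<open>B\<close>; the padding by 0 there
    matches the values -1 of \<open>u\<close> and 0 of \<open>v\<close>.\<close>
  have "disp ?x i j = u i * v j - u j * v i" if ij: "i \<le> m" "j \<le> m" for i j
  proof -
    consider "i < m" "j < m" | "i < m" "j = m" | "i = m" "j < m" | "i = m" "j = m"
      using ij by linarith
    then show ?thesis
    proof cases
      case 1
      then have "disp ?x i j = (if j = 0 then 0 else B $$ (i, j - 1)) - (if i = 0 then 0 else B $$ (i - 1, j))"
        by (auto simp: disp_def ent)
      then show ?thesis using main[OF 1] 1 Bsym[of n j] by (simp add: u_def v_def n algebra_simps)
    qed (use Bsym[of n] in \<open>auto simp: disp_def u_def v_def n ent[unfolded n]\<close>)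
  qed
  then have "bez_map m ?x = plucker m u v"
    by (simp add: bez_map_eq_plucker_iff[OF sym_coords_coord_space])
  then show ?thesis by blast
qed


section \<open>Nonsingular Bezoutians\<close>

text \<open>Each entry can be moved along its antidiagonal to the first row or to the last column,
  and \<theta> is read off from this hook.\<close>

lemma hankel_matI:
  fixes H :: "'a mat"
  assumes H: "H \<in> carrier_mat m m"
    and shift: "\<And>p q. Suc p < m \<Longrightarrow> Suc q < m \<Longrightarrow> H $$ (Suc p, q) = H $$ (p, Suc q)"
  shows "H \<in> hankel_mats m"
proof -
  define \<theta> where "\<theta> s = (if s < m then H $$ (0, s) else H $$ (s - (m - 1), m - 1))" for s
  have low: "H $$ (p, q) = H $$ (0, p + q)" if "p + q < m" for p q
    using that
  proof (induction p arbitrary: q)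
    case (Suc p)
    then show ?case using shift[of p q] Suc.IH[of "Suc q"] by simp
  qed simp
  have high: "H $$ (p, q) = H $$ (p + q - (m - 1), m - 1)" if "q < m" "p < m" "m - 1 \<le> p + q" for p q
    using that
  proof (induction "m - 1 - q" arbitrary: p q)
    case 0
    then have "m = Suc q" by simp
    then show ?case by simp
  next
    case (Suc d)
    then have q: "Suc q < m" and p: "0 < p" by linarith+
    then obtain p' where p': "p = Suc p'" using gr0_implies_Suc by blast
    have "H $$ (p', Suc q) = H $$ (p' + Suc q - (m - 1), m - 1)"
      using Suc.hyps(2) Suc.prems p' q by (intro Suc.hyps(1)) auto
    then show ?case using shift[of p' q] q Suc.prems p' by simp
  qed
  have "H = mat m m (\<lambda>(i, j). \<theta> (i + j))"
  proof (rule eq_matI)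
    fix i j assume "i < dim_row (mat m m (\<lambda>(i, j). \<theta> (i + j)))" "j < dim_col (mat m m (\<lambda>(i, j). \<theta> (i + j)))"
    then show "H $$ (i, j) = mat m m (\<lambda>(i, j). \<theta> (i + j)) $$ (i, j)"
      using low[of i j] high[of j i] by (simp add: \<theta>_def)
  qed (use H in auto)
  then show ?thesis unfolding hankel_mats_def by blast
qed

definition sym_of_coords :: "nat \<Rightarrow> (nat \<times> nat \<Rightarrow> 'a) \<Rightarrow> 'a mat" where
  "sym_of_coords m x = mat m m (\<lambda>(i, j). sym_entry x i j)"

lemma sym_of_coords_carrier: "sym_of_coords m x \<in> carrier_mat m m"
  by (simp add: sym_of_coords_def)

lemma sym_coords_sym_of_coords:
  "x \<in> coord_space (sym_index m) \<Longrightarrow> sym_coords m (sym_of_coords m x) = x"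
  by (auto simp: sym_coords_def sym_of_coords_def sym_entry_def fun_eq_iff mem_sym_index coord_space_def)

text \<open>Multiplying the displacement of \<open>B\<close> by its inverse \<open>H\<close> on both
  sides gives \<open>H (p + 1, q) - H (p, q + 1) = \<alpha> p * \<beta> q - \<beta> p * \<alpha>
  q\<close>, where \<alpha> is \<open>H u\<close> and \<beta> is \<open>H v\<close>. The right-hand
  side vanishes for \<open>p, q < m - 1\<close>, so \<open>H\<close> is Hankel.\<close>

lemma nonsingular_decomposable_inverse_hankel:
  fixes x :: "nat \<times> nat \<Rightarrow> 'a::field"
  assumes x: "x \<in> coord_space (sym_index m)" and m: "0 < m"
    and dec: "bez_map m x = plucker m u v" and det: "det (sym_of_coords m x) \<noteq> 0"
  shows "x \<in> sym_coords m ` inverse_mats m (hankel_mats m)"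
proof -
  define B where "B = sym_of_coords m x"
  have B_entry: "B $$ (i, j) = sym_entry x i j" if "i < m" "j < m" for i j
    using that by (simp add: B_def sym_of_coords_def)
  have B: "B \<in> carrier_mat m m" by (simp add: B_def sym_of_coords_carrier)
  obtain H where H: "H \<in> carrier_mat m m" and HB: "H * B = 1\<^sub>m m" and BH: "B * H = 1\<^sub>m m"
    using det_non_zero_imp_unit[OF B, of "()"] det unfolding B_def[symmetric] Units_def ring_mat_def
    by auto
  obtain n where n: "m = Suc n" using m gr0_implies_Suc by blast
  have disp: "disp x i j = u i * v j - u j * v i" if "i \<le> m" "j \<le> m" for i j
    using dec that by (simp add: bez_map_eq_plucker_iff[OF x])
  define b where "b = sym_entry x"
  have b_out: "b i j = 0" if "m \<le> i \<or> m \<le> j" for i j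
    using sym_entry_outside[OF x that] by (simp add: b_def)
  define \<alpha> where "\<alpha> p = (\<Sum>i<m. H $$ (p, i) * u i)" for p
  define \<beta> where "\<beta> p = (\<Sum>i<m. H $$ (p, i) * v i)" for p
  have HBe: "(\<Sum>i<m. H $$ (p, i) * b i j) = (if p = j then 1 else 0)" if "p < m" "j < m" for p j
    using inverse_mats_entries[OF H B _ that] HB H that by (simp add: inverts_mat_def b_def B_entry)
  have BHe: "(\<Sum>j<m. b i j * H $$ (j, q)) = (if i = q then 1 else 0)" if "i < m" "q < m" for i q
    using inverse_mats_entries[OF B H _ that] BH B that by (simp add: inverts_mat_def b_def B_entry)
  \<comment> \<open>Column \<open>m\<close> of the displacement is the last column of
    \<open>B\<close>, because \<open>B\<close> has no column \<open>m\<close>; multiplication by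
    \<open>H\<close> turns it into the last unit vector.\<close>
  have last: "\<alpha> p * v m - \<beta> p * u m = (if p = n then 1 else 0)" if "p < m" for p
  proof -
    have "disp x i m = b i n" for i
      using b_out[of "i - 1" m] n by (simp add: disp_def b_def)
    then have "(\<Sum>i<m. H $$ (p, i) * disp x i m) = (if p = n then 1 else 0)"
      using HBe[OF that, of n] n by simp
    then show ?thesis
      by (simp add: disp \<alpha>_def \<beta>_def sum_distrib_left sum_distrib_right sum_subtractf[symmetric]
          algebra_simps)
  qed
  have H_sym: "H $$ (p, q) = H $$ (q, p)" if "p < m" "q < m" for p q
  proof -
    have "B \<in> sym_mats m"
      using B by (auto simp: sym_mats_def B_entry sym_entry_commute intro!: eq_matI)
    moreover have "H \<in> inverse_mats m {B}"
      using H HB BH B det by (auto simp: inverse_mats_def inverts_mat_def B_def[symmetric])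
    ultimately have "H \<in> sym_mats m" using inverse_mats_sym[of "{B}" m] by auto
    then show ?thesis
      using sym_entry_sym_coords[of H m p q] sym_entry_sym_coords[of H m q p] that
      by (simp add: sym_entry_commute)
  qed
  have shift: "H $$ (Suc p, q) - H $$ (p, Suc q) = \<alpha> p * \<beta> q - \<beta> p * \<alpha> q" if p: "p < n" and q: "q < n" for p q
  proof -
    \<comment> \<open>In the first half of the displacement the shift affects the column index, and
      \<open>H * B = 1\<close> collapses the sum. In the second half it affects the row index, and
      \<open>B * H = 1\<close> does so.\<close>
    have "(\<Sum>i<m. H $$ (p, i) * (\<Sum>j<m. (if j = 0 then 0 else b i (j - 1)) * H $$ (j, q)))
       = (\<Sum>i<m. H $$ (p, i) * (\<Sum>j<n. b i j * H $$ (Suc j, q)))"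
      by (simp add: n sum.lessThan_Suc_shift del: sum.lessThan_Suc)
    also have "\<dots> = (\<Sum>j<n. (\<Sum>i<m. H $$ (p, i) * b i j) * H $$ (Suc j, q))"
      by (simp only: sum_distrib_left sum_distrib_right mult.assoc) (rule sum.swap)
    also have "\<dots> = (\<Sum>j<n. if j = p then H $$ (Suc j, q) else 0)"
      by (rule sum.cong[OF refl], subst HBe) (use p q n in auto)
    also have "\<dots> = H $$ (Suc p, q)" using p by simp
    finally have 1: "(\<Sum>i<m. H $$ (p, i) * (\<Sum>j<m. (if j = 0 then 0 else b i (j - 1)) * H $$ (j, q)))
      = H $$ (Suc p, q)" .
    have "(\<Sum>i<m. H $$ (p, i) * (\<Sum>j<m. (if i = 0 then 0 else b (i - 1) j) * H $$ (j, q)))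
       = (\<Sum>i<n. H $$ (p, Suc i) * (\<Sum>j<m. b i j * H $$ (j, q)))"
      by (simp add: n sum.lessThan_Suc_shift del: sum.lessThan_Suc)
    also have "\<dots> = (\<Sum>i<n. if i = q then H $$ (p, Suc i) else 0)"
      by (rule sum.cong[OF refl], subst BHe) (use p q n in auto)
    also have "\<dots> = H $$ (p, Suc q)" using q by simp
    finally have 2: "(\<Sum>i<m. H $$ (p, i) * (\<Sum>j<m. (if i = 0 then 0 else b (i - 1) j) * H $$ (j, q)))
      = H $$ (p, Suc q)" .
    have \<alpha>q: "\<alpha> q = (\<Sum>j<m. u j * H $$ (j, q))" and \<beta>q: "\<beta> q = (\<Sum>j<m. v j * H $$ (j, q))"
      using H_sym q n by (auto simp: \<alpha>_def \<beta>_def mult.commute intro!: sum.cong)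
    have "H $$ (Suc p, q) - H $$ (p, Suc q) = (\<Sum>i<m. H $$ (p, i) * (\<Sum>j<m. disp x i j * H $$ (j, q)))"
      unfolding 1[symmetric] 2[symmetric] sum_subtractf[symmetric] right_diff_distrib[symmetric]
        left_diff_distrib[symmetric] disp_def b_def ..
    also have "\<dots> = (\<Sum>i<m. H $$ (p, i) * (u i * \<beta> q - v i * \<alpha> q))"
      by (simp add: disp \<alpha>q \<beta>q sum_distrib_left sum_subtractf[symmetric] algebra_simps)
    also have "\<dots> = \<alpha> p * \<beta> q - \<beta> p * \<alpha> q"
      by (simp add: \<alpha>_def[of p] \<beta>_def[of p] sum_distrib_left sum_distrib_right sum_subtractf[symmetric] algebra_simps)
    finally show ?thesis .
  qed
  \<comment> \<open>By \<open>last\<close>, the pairs \<open>(\<alpha> p, \<beta> p)\<close> with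
    \<open>p < n\<close> are proportional to \<open>(u m, v m)\<close>, which is nonzero by the case
    \<open>p = n\<close>. Hence they are proportional to each other.\<close>
  have uv: "u m \<noteq> 0 \<or> v m \<noteq> 0" using last[of n] n by auto
  have cross: "\<alpha> p * \<beta> q = \<beta> p * \<alpha> q" if "p < n" "q < n" for p q
  proof -
    have pq: "\<alpha> p * v m = \<beta> p * u m" "\<alpha> q * v m = \<beta> q * u m"
      using last[of p] last[of q] that n by auto
    from uv show ?thesis
    proof
      assume "v m \<noteq> 0"
      moreover have "(\<alpha> p * v m) * \<beta> q = \<beta> p * (\<alpha> q * v m)" unfolding pq by (simp add: ac_simps)
      ultimately show ?thesis by (simp add: ac_simps)
    next
      assume "u m \<noteq> 0"
      moreover have "\<alpha> p * (\<beta> q * u m) = (\<beta> p * u m) * \<alpha> q" unfolding pq[symmetric] by (simp add: ac_simps)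
      ultimately show ?thesis by (simp add: ac_simps)
    qed
  qed
  have "H \<in> hankel_mats m"
    using shift cross n by (intro hankel_matI[OF H]) auto
  moreover have "det H \<noteq> 0"
    using HB det_mult[OF H B] by auto
  ultimately have "B \<in> inverse_mats m (hankel_mats m)"
    using B H HB BH by (auto simp: inverse_mats_def inverts_mat_def intro!: bexI[of _ H])
  then show ?thesis
    using sym_coords_sym_of_coords[OF x] by (force simp: B_def)
qed

section \<open>Density of the nonsingular Bezoutians\<close>

text \<open>A predicate on functions, so that closure rules apply directly to determinants and to
  evaluations along a curve.\<close>

definition polyfun :: "('a::comm_ring_1 \<Rightarrow> 'a) \<Rightarrow> bool" where
  "polyfun f \<longleftrightarrow> (\<exists>p. f = poly p)"

lemma polyfun_const: "polyfun (\<lambda>_. c)"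
  unfolding polyfun_def by (rule exI[of _ "[:c:]"]) auto

lemma polyfun_id: "polyfun (\<lambda>s. s)"
  unfolding polyfun_def by (rule exI[of _ "[:0, 1:]"]) auto

lemma polyfun_add: "polyfun f \<Longrightarrow> polyfun g \<Longrightarrow> polyfun (\<lambda>s. f s + g s)"
  unfolding polyfun_def by (auto simp: fun_eq_iff simp flip: poly_add)

lemma polyfun_diff: "polyfun f \<Longrightarrow> polyfun g \<Longrightarrow> polyfun (\<lambda>s. f s - g s)"
  unfolding polyfun_def by (auto simp: fun_eq_iff simp flip: poly_diff)

lemma polyfun_mult: "polyfun f \<Longrightarrow> polyfun g \<Longrightarrow> polyfun (\<lambda>s. f s * g s)"
  unfolding polyfun_def by (auto simp: fun_eq_iff simp flip: poly_mult)

lemma polyfun_sum: "(\<And>i. i \<in> I \<Longrightarrow> polyfun (f i)) \<Longrightarrow> polyfun (\<lambda>s. \<Sum>i\<in>I. f i s)"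
  by (induction I rule: infinite_finite_induct) (auto intro: polyfun_const polyfun_add)

lemma polyfun_prod: "(\<And>i. i \<in> I \<Longrightarrow> polyfun (f i)) \<Longrightarrow> polyfun (\<lambda>s. \<Prod>i\<in>I. f i s)"
  by (induction I rule: infinite_finite_induct) (auto intro: polyfun_const polyfun_mult)

lemma polyfun_power: "polyfun f \<Longrightarrow> polyfun (\<lambda>s. f s ^ k)"
  by (induction k) (auto intro: polyfun_const polyfun_mult)

lemmas polyfun_intros = polyfun_const polyfun_id polyfun_add polyfun_diff polyfun_mult polyfun_sum
  polyfun_prod polyfun_power

lemma polyfun_det:
  assumes "\<And>s. A s \<in> carrier_mat n n" "\<And>i j. i < n \<Longrightarrow> j < n \<Longrightarrow> polyfun (\<lambda>s. A s $$ (i, j))"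
  shows "polyfun (\<lambda>s. det (A s))"
  unfolding det_def'[OF assms(1)]
  by (intro polyfun_intros assms(2)) (auto simp: permutes_in_image)

lemma polyfun_eval_mpoly:
  assumes "\<And>i. polyfun (\<lambda>s. x s i)"
  shows "polyfun (\<lambda>s. eval_mpoly p (x s))"
  unfolding eval_mpoly_def by (intro polyfun_intros assms)

text \<open>The product of \<open>f\<close> and \<open>g\<close> vanishes everywhere, hence as a
  polynomial since the field is infinite, and polynomials over a field have no zero
  divisors.\<close>

lemma polyfun_eq_zero:
  fixes f g :: "'a::field_char_0 \<Rightarrow> 'a"
  assumes "polyfun f" "polyfun g" "g a \<noteq> 0" "\<And>s. g s \<noteq> 0 \<Longrightarrow> f s = 0"
  shows "f s = 0"
proof -
  obtain p q where pq: "f = poly p" "g = poly q" using assms by (auto simp: polyfun_def)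
  then have "poly (p * q) = poly 0" using assms(4) by (auto simp: fun_eq_iff)
  then have "p * q = 0" by (simp only: poly_eq_poly_eq_iff)
  moreover have "q \<noteq> 0" using assms(3) pq by auto
  ultimately show ?thesis by (simp add: pq)
qed

text \<open>The matrix is its own inverse.\<close>

lemma det_anti_identity:
  "det (mat m m (\<lambda>(i, j). if i + j + 1 = m then 1 else 0) :: 'a::field mat) \<noteq> 0"
proof -
  let ?J = "mat m m (\<lambda>(i, j). if i + j + 1 = m then 1 else 0) :: 'a mat"
  have "?J * ?J = 1\<^sub>m m"
  proof (rule eq_matI)
    fix i j assume "i < dim_row (1\<^sub>m m :: 'a mat)" "j < dim_col (1\<^sub>m m :: 'a mat)"
    then have ij: "i < m" "j < m" by auto
    then have "(?J * ?J) $$ (i, j) = (\<Sum>k\<in>{0..<m}. (if i + k + 1 = m then 1 else 0) * (if k + j + 1 = m then 1 else 0))"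
      by (simp add: scalar_prod_def)
    also have "\<dots> = (\<Sum>k\<in>{0..<m}. if k = m - 1 - i then (if i = j then 1 else 0) else 0)"
      using ij by (intro sum.cong) auto
    also have "\<dots> = 1\<^sub>m m $$ (i, j)" using ij by auto
    finally show "(?J * ?J) $$ (i, j) = 1\<^sub>m m $$ (i, j)" .
  qed auto
  then have "det ?J * det ?J = 1"
    using det_mult[of ?J m ?J] by simp
  then show ?thesis by auto
qed

text \<open>Join the given point to the Bezoutian of \<open>1\<close> and \<open>X\<^sup>m\<close>, which is nonsingular: on the
  curve obtained, all but finitely many points are inverses of Hankel matrices.\<close>

lemma decomposable_in_inverse_variety:
  fixes x :: "nat \<times> nat \<Rightarrow> 'a::field_char_0"
  assumes x: "x \<in> coord_space (sym_index m)" and m: "0 < m" and dec: "bez_map m x = plucker m u v"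
  shows "x \<in> inverse_variety m (hankel_mats m)"
proof -
  define U where "U s i = (1 - s) * (if i = 0 then 1 else 0) + s * u i" for s i
  define V where "V s i = (1 - s) * (if i = m then 1 else 0) + s * v i" for s i
  define \<gamma> where "\<gamma> s = bez_inv m (plucker m (U s) (V s))" for s
  have \<gamma>_coord: "\<gamma> s \<in> coord_space (sym_index m)" for s
    by (simp add: \<gamma>_def bez_inv_coord_space)
  have \<gamma>_dec: "bez_map m (\<gamma> s) = plucker m (U s) (V s)" for s
    by (simp add: \<gamma>_def bez_map_bez_inv plucker_coord_space)
  have \<gamma>1: "\<gamma> 1 = x"
    using bez_inv_bez_map[OF x] by (simp add: \<gamma>_def dec U_def[abs_def] V_def[abs_def])
  have pl: "polyfun (\<lambda>s. plucker m (U s) (V s) q)" for q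
    by (cases q; cases "q \<in> plucker_index m")
       (auto simp: plucker_def U_def V_def intro!: polyfun_intros)
  have \<gamma>_poly: "polyfun (\<lambda>s. \<gamma> s i)" for i
    by (cases i; cases "i \<in> sym_index m") (auto simp: \<gamma>_def bez_inv_def intro!: polyfun_intros pl)
  have entry_poly: "polyfun (\<lambda>s. sym_of_coords m (\<gamma> s) $$ (i, j))" if "i < m" "j < m" for i j
    using that \<gamma>_poly by (cases "i \<le> j") (auto simp: sym_of_coords_def sym_entry_def)
  have det_poly: "polyfun (\<lambda>s. det (sym_of_coords m (\<gamma> s)))"
    by (rule polyfun_det[OF sym_of_coords_carrier entry_poly])
  \<comment> \<open>The Bezoutian of 1 and \<open>X^m\<close> is
    \<open>(y^m - x^m) / (y - x)\<close>, whose coefficients form the anti-identity.\<close>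
  have \<gamma>0: "\<gamma> 0 (i, j) = (if i + j + 1 = m then 1 else 0)" if "i \<le> j" "j < m" for i j
  proof -
    have "plucker m (U 0) (V 0) (a, b) = (if a = 0 \<and> b = m then 1 else 0)" for a b
      using m by (auto simp: plucker_def mem_plucker_index U_def V_def)
    then have "\<gamma> 0 (i, j) = (\<Sum>l\<le>i. if i - l = 0 \<and> j + 1 + l = m then 1 else 0)"
      using that by (simp add: \<gamma>_def bez_inv_def mem_sym_index)
    also have "\<dots> = (\<Sum>l\<le>i. if l = i then (if i + j + 1 = m then 1 else 0) else 0)"
      by (intro sum.cong) auto
    finally show ?thesis by simp
  qed
  have "sym_of_coords m (\<gamma> 0) = mat m m (\<lambda>(i, j). if i + j + 1 = m then 1 else 0)"
    by (intro eq_matI) (auto simp: sym_of_coords_def sym_entry_def \<gamma>0 add.commute)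
  then have det0: "det (sym_of_coords m (\<gamma> 0)) \<noteq> 0" using det_anti_identity[where ?'a = 'a and m = m] by simp
  show ?thesis
    unfolding inverse_variety_def zariski_closure_def
  proof (intro CollectI conjI x ballI impI)
    fix p :: "(nat \<times> nat, 'a) mpoly"
    assume p: "\<forall>y\<in>sym_coords m ` inverse_mats m (hankel_mats m). eval_mpoly p y = 0"
    have "eval_mpoly p (\<gamma> 1) = 0"
      by (rule polyfun_eq_zero[OF polyfun_eval_mpoly[OF \<gamma>_poly] det_poly det0])
         (use p nonsingular_decomposable_inverse_hankel[OF \<gamma>_coord m \<gamma>_dec] in blast)
    then show "eval_mpoly p x = 0" by (simp add: \<gamma>1)
  qed
qed

section \<open>The cone over the Grassmannian as the set of decomposable vectors\<close>

lemma plucker_scale: "fun_scale c (plucker m u v) = plucker m (fun_scale c u) v"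
  by (auto simp: plucker_def fun_scale_def fun_eq_iff algebra_simps)

text \<open>\<open>plucker\<close> reads only the entries up to index \<open>m\<close>, so both
  vectors may be truncated, and a nonzero value forces them to span a plane.\<close>

lemma grassmannian_cone_eq:
  assumes m: "0 < m"
  shows "grassmannian_cone m = {plucker m u v | u v :: nat \<Rightarrow> 'a::field. True}" (is "?L = ?R")
proof
  show "?L \<subseteq> ?R"
    by (auto simp: grassmannian_cone_def plucker_line_def plucker_scale)
next
  have mem: "fun_scale c (plucker m u v) \<in> ?L"
    if uv: "u \<in> coord_space {..<m + 1}" "v \<in> coord_space {..<m + 1}" and nz: "plucker m u v \<noteq> 0"
    for c and u v :: "nat \<Rightarrow> 'a"
  proof -
    obtain i j where ij: "u i * v j - u j * v i \<noteq> 0"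
      using nz by (auto simp: plucker_def fun_eq_iff split: if_splits)
    have neq: "u \<noteq> v" using ij by (auto simp: algebra_simps)
    have "fun_vs.independent {u, v}"
    proof
      assume "fun_vs.dependent {u, v}"
      then obtain w where w: "w u \<noteq> 0 \<or> w v \<noteq> 0" and s: "(\<Sum>x\<in>{u, v}. fun_scale (w x) x) = 0"
        by (auto simp: fun_vs.dependent_finite)
      have e: "w u * u l + w v * v l = 0" for l
        using fun_cong[OF s, of l] neq by (simp add: fun_scale_def)
      \<comment> \<open>Cramer's rule: since the minor is nonzero, both coefficients vanish.\<close>
      have "w u * (u i * v j - u j * v i) = (w u * u i + w v * v i) * v j - (w u * u j + w v * v j) * v i"
        by (simp add: algebra_simps)
      moreover have "w v * (u i * v j - u j * v i) = (w u * u j + w v * v j) * u i - (w u * u i + w v * v i) * u j"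
        by (simp add: algebra_simps)
      ultimately show False using w ij e by auto
    qed
    then have "fun_vs.dim (fun_vs.span {u, v}) = 2"
      using neq by (simp add: fun_vs.dim_span fun_vs.dim_eq_card_independent)
    moreover have "fun_vs.subspace (coord_space {..<m + 1} :: (nat \<Rightarrow> 'a) set)"
      by (auto simp: fun_vs.subspace_def coord_space_def fun_scale_def)
    then have "fun_vs.span {u, v} \<subseteq> coord_space {..<m + 1}"
      using uv by (intro fun_vs.span_minimal) auto
    ultimately have "fun_vs.span {u, v} \<in> grassmannian 2 (m + 1)"
      by (auto simp: grassmannian_def fun_vs.subspace_span)
    then show ?thesis unfolding grassmannian_cone_def plucker_line_def by blast
  qed
  show "?R \<subseteq> ?L"
  proof clarify
    fix u v :: "nat \<Rightarrow> 'a"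
    define t where "t w = (\<lambda>i. if i \<le> m then w i else 0)" for w :: "nat \<Rightarrow> 'a"
    have t: "t w \<in> coord_space {..<m + 1}" for w
      by (auto simp: t_def coord_space_def)
    have uv: "plucker m u v = plucker m (t u) (t v)"
      by (auto simp: plucker_def t_def fun_eq_iff mem_plucker_index)
    show "plucker m u v \<in> ?L"
    proof (cases "plucker m u v = 0")
      case False
      then show ?thesis using mem[OF t t, of u v 1] by (simp add: uv)
    next
      case True
      \<comment> \<open>The apex of the cone is 0 times the Pluecker vector of some plane, here that
        of the first two unit vectors, which exist because \<open>0 < m\<close>.\<close>
      define e where "e k = t (\<lambda>i. if i = k then 1 else 0)" for k
      have "plucker m (e 0) (e 1) (0, 1) \<noteq> 0"
        using m by (simp add: plucker_def mem_plucker_index e_def t_def)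
      then have "plucker m (e 0) (e 1) \<noteq> 0" by auto
      then have "fun_scale 0 (plucker m (e 0) (e 1)) \<in> ?L"
        unfolding e_def by (rule mem[OF t t])
      then show ?thesis using True by simp
    qed
  qed
qed


section \<open>Homogeneous coordinate rings\<close>

definition list_product :: "('i \<Rightarrow> 'x \<Rightarrow> 'a::comm_monoid_mult) \<Rightarrow> 'i list \<Rightarrow> 'x \<Rightarrow> 'a" where
  "list_product f is x = (\<Prod>i\<leftarrow>is. f i x)"

lemma list_product_Nil: "list_product f [] = (\<lambda>_. 1)"
  by (simp add: list_product_def fun_eq_iff)

lemma list_product_Cons: "list_product f (i # is) = (\<lambda>x. f i x * list_product f is x)"
  by (simp add: list_product_def fun_eq_iff)

text \<open>The degree \<open>k\<close> part of the algebra generated by the functions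
  \<open>f i\<close>. Words of length \<open>k\<close> instead of exponent vectors let a change of
  generators act on one factor at a time.\<close>

definition homogeneous_span :: "('i \<Rightarrow> 'x \<Rightarrow> 'a::field) \<Rightarrow> 'i set \<Rightarrow> nat \<Rightarrow> ('x \<Rightarrow> 'a) set" where
  "homogeneous_span f I k = fun_vs.span (list_product f ` {is. set is \<subseteq> I \<and> length is = k})"

text \<open>Multiplication by \<open>f\<close> is linear, so this is the preimage of a subspace. It
  serves to extend statements about products from generators to spans.\<close>

lemma subspace_mult_left:
  "fun_vs.subspace V \<Longrightarrow> fun_vs.subspace {g. (\<lambda>x. f x * g x) \<in> V}" for V :: "('x \<Rightarrow> 'a::field) set"
proof (rule fun_vs.subspaceI)
  assume V: "fun_vs.subspace V"
  show "0 \<in> {g. (\<lambda>x. f x * g x) \<in> V}"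
    using fun_vs.subspace_0[OF V] by (simp add: zero_fun_def)
  show "g + h \<in> {g. (\<lambda>x. f x * g x) \<in> V}"
    if "g \<in> {g. (\<lambda>x. f x * g x) \<in> V}" "h \<in> {g. (\<lambda>x. f x * g x) \<in> V}" for g h
    using fun_vs.subspace_add[OF V, of "\<lambda>x. f x * g x" "\<lambda>x. f x * h x"] that
    by (simp add: plus_fun_def distrib_left)
  show "fun_scale c g \<in> {g. (\<lambda>x. f x * g x) \<in> V}" if "g \<in> {g. (\<lambda>x. f x * g x) \<in> V}" for c g
    using fun_vs.subspace_scale[OF V, of "\<lambda>x. f x * g x" c] that
    by (simp add: fun_scale_def mult.left_commute)
qed

lemma homogeneous_span_mult:
  assumes g: "g \<in> fun_vs.span (f ` I)" and h: "h \<in> homogeneous_span f I k"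
  shows "(\<lambda>x. g x * h x) \<in> homogeneous_span f I (Suc k)"
proof -
  have 1: "(\<lambda>x. f i x * h x) \<in> homogeneous_span f I (Suc k)" if i: "i \<in> I" for i
    using h unfolding homogeneous_span_def[of f I k]
  proof (rule fun_vs.span_induct)
    show "fun_vs.subspace {h. (\<lambda>x. f i x * h x) \<in> homogeneous_span f I (Suc k)}"
      unfolding homogeneous_span_def by (intro subspace_mult_left fun_vs.subspace_span)
    fix g assume "g \<in> list_product f ` {is. set is \<subseteq> I \<and> length is = k}"
    then obtain "is" where "g = list_product f is" "set is \<subseteq> I" "length is = k" by blast
    then have "(\<lambda>x. f i x * g x) = list_product f (i # is)" "set (i # is) \<subseteq> I" "length (i # is) = Suc k"
      using i by (auto simp: list_product_Cons)
    then show "(\<lambda>x. f i x * g x) \<in> homogeneous_span f I (Suc k)"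
      unfolding homogeneous_span_def by (metis (mono_tags, lifting) fun_vs.span_base image_eqI mem_Collect_eq)
  qed
  have "(\<lambda>x. h x * g x) \<in> homogeneous_span f I (Suc k)"
    using g
  proof (rule fun_vs.span_induct)
    show "fun_vs.subspace {g. (\<lambda>x. h x * g x) \<in> homogeneous_span f I (Suc k)}"
      unfolding homogeneous_span_def by (intro subspace_mult_left fun_vs.subspace_span)
  qed (use 1 in \<open>auto simp: mult.commute\<close>)
  then show ?thesis by (simp add: mult.commute)
qed

text \<open>The factors are replaced, one at a time, by linear combinations of the generators
  \<open>f i\<close>.\<close>

lemma homogeneous_span_mono:
  assumes "g ` J \<subseteq> fun_vs.span (f ` I)"
  shows "homogeneous_span g J k \<subseteq> homogeneous_span f I k"
proof -
  have "list_product g js \<in> homogeneous_span f I (length js)" if "set js \<subseteq> J" for js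
    using that
  proof (induction js)
    case Nil
    have "list_product g [] = list_product f []" by (simp add: list_product_Nil)
    then show ?case unfolding homogeneous_span_def by (auto intro: fun_vs.span_base)
  next
    case (Cons j js)
    then show ?case using assms by (auto simp: list_product_Cons intro!: homogeneous_span_mult)
  qed
  then show ?thesis
    unfolding homogeneous_span_def[of g]
    by (intro fun_vs.span_minimal) (auto simp: homogeneous_span_def fun_vs.subspace_span)
qed

lemma homogeneous_span_eq:
  assumes "g ` J \<subseteq> fun_vs.span (f ` I)" "f ` I \<subseteq> fun_vs.span (g ` J)"
  shows "homogeneous_span g J k = homogeneous_span f I k"
  using assms by (intro equalityI homogeneous_span_mono)

section \<open>Forms restricted to a cone\<close>

lemma eval_mpoly_superset:
  assumes "finite K" "Poly_Mapping.keys p \<subseteq> K"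
  shows "eval_mpoly p x = (\<Sum>e\<in>K. Poly_Mapping.lookup p e *
    (\<Prod>i\<in>Poly_Mapping.keys e. x i ^ Poly_Mapping.lookup e i))"
  unfolding eval_mpoly_def using assms by (intro sum.mono_neutral_left) (auto simp: in_keys_iff)

lemma eval_mpoly_add: "eval_mpoly (p + q) x = eval_mpoly p x + eval_mpoly q x"
proof -
  let ?K = "Poly_Mapping.keys p \<union> Poly_Mapping.keys q"
  have "eval_mpoly (p + q) x = (\<Sum>e\<in>?K. Poly_Mapping.lookup (p + q) e *
    (\<Prod>i\<in>Poly_Mapping.keys e. x i ^ Poly_Mapping.lookup e i))"
    by (rule eval_mpoly_superset) (auto simp: keys_add)
  then show ?thesis
    using eval_mpoly_superset[of ?K p x] eval_mpoly_superset[of ?K q x]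
    by (simp add: lookup_add distrib_right sum.distrib)
qed

lemma keys_map_mult: "Poly_Mapping.keys (Poly_Mapping.map ((*) c) p) \<subseteq> Poly_Mapping.keys p"
  for c :: "'a::comm_semiring_1"
  by (auto simp: in_keys_iff Poly_Mapping.map.rep_eq when_def)

lemma eval_mpoly_map_mult: "eval_mpoly (Poly_Mapping.map ((*) c) p) x = c * eval_mpoly p x"
proof -
  have "Poly_Mapping.lookup (Poly_Mapping.map ((*) c) p) e = c * Poly_Mapping.lookup p e" for e
    by (simp add: Poly_Mapping.map.rep_eq when_def)
  then show ?thesis
    using eval_mpoly_superset[OF finite_keys keys_map_mult, of c p x]
    by (simp add: eval_mpoly_def sum_distrib_left mult.assoc)
qed

lemma subspace_coord_ring_part:
  fixes X :: "('i \<Rightarrow> 'a::field) set"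
  shows "fun_vs.subspace (coord_ring_part I X k)"
proof (rule fun_vs.subspaceI)
  have "(0 :: ('i, 'a) mpoly) \<in> forms I k" by (simp add: forms_def mpolys_def)
  then show "0 \<in> coord_ring_part I X k"
    unfolding coord_ring_part_def by (rule image_eqI[rotated]) (auto simp: eval_mpoly_def)
next
  fix f g assume "f \<in> coord_ring_part I X k" "g \<in> coord_ring_part I X k"
  then obtain p q where pq: "p \<in> forms I k" "q \<in> forms I k"
    "f = (\<lambda>x. if x \<in> X then eval_mpoly p x else 0)" "g = (\<lambda>x. if x \<in> X then eval_mpoly q x else 0)"
    by (auto simp: coord_ring_part_def)
  then have "p + q \<in> forms I k" using keys_add[of p q] unfolding forms_def mpolys_def by blast
  then show "f + g \<in> coord_ring_part I X k"
    unfolding coord_ring_part_def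
    by (rule image_eqI[rotated]) (auto simp: pq eval_mpoly_add fun_eq_iff)
next
  fix c f assume "f \<in> coord_ring_part I X k"
  then obtain p where p: "p \<in> forms I k" "f = (\<lambda>x. if x \<in> X then eval_mpoly p x else 0)"
    by (auto simp: coord_ring_part_def)
  then have "Poly_Mapping.map ((*) c) p \<in> forms I k"
    using keys_map_mult[of c p] unfolding forms_def mpolys_def by blast
  then show "fun_scale c f \<in> coord_ring_part I X k"
    unfolding coord_ring_part_def
    by (rule image_eqI[rotated]) (auto simp: p eval_mpoly_map_mult fun_eq_iff fun_scale_def)
qed

lemma monomial_as_list_product:
  assumes "finite K"
  shows "\<exists>is. set is \<subseteq> K \<and> length is = (\<Sum>i\<in>K. e i) \<and>
    (\<forall>x :: 'i \<Rightarrow> 'a::comm_semiring_1. (\<Prod>i\<leftarrow>is. x i) = (\<Prod>i\<in>K. x i ^ e i))"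
  using assms
proof (induction K rule: finite_induct)
  case (insert k K)
  then obtain "is" where "set is \<subseteq> K" "length is = (\<Sum>i\<in>K. e i)"
    "\<forall>x :: 'i \<Rightarrow> 'a. (\<Prod>i\<leftarrow>is. x i) = (\<Prod>i\<in>K. x i ^ e i)" by blast
  with insert show ?case
    by (intro exI[of _ "replicate (e k) k @ is"]) (auto simp: prod_list_replicate split: if_splits)
qed simp

lemma list_product_as_monomial:
  "\<exists>e. Poly_Mapping.keys e = set is \<and> (\<Sum>i\<in>Poly_Mapping.keys e. Poly_Mapping.lookup e i) = length is \<and>
    (\<forall>x :: 'i \<Rightarrow> 'a::comm_semiring_1. (\<Prod>i\<in>Poly_Mapping.keys e. x i ^ Poly_Mapping.lookup e i) = (\<Prod>i\<leftarrow>is. x i))"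
proof -
  define e where "e = Abs_poly_mapping (count_list is)"
  have "finite {i. count_list is i \<noteq> 0}" by (simp add: count_list_0_iff)
  then have e: "Poly_Mapping.lookup e = count_list is" by (simp add: e_def)
  have k: "Poly_Mapping.keys e = set is" by (auto simp: in_keys_iff e count_list_0_iff)
  have "(\<Prod>i\<in>K. x i ^ count_list js i) = (\<Prod>i\<leftarrow>js. x i)" if "finite K" "set js \<subseteq> K"
    for K js and x :: "'i \<Rightarrow> 'a"
    using that(2)
  proof (induction js)
    case (Cons j js)
    have "(\<Prod>i\<in>K. x i ^ count_list (j # js) i) = (\<Prod>i\<in>K. (if i = j then x i else 1) * x i ^ count_list js i)"
      by (intro prod.cong) auto
    then show ?case using Cons that(1) by (simp add: prod.distrib)
  qed simp
  moreover have "(\<Sum>i\<in>set is. count_list is i) = length is"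
    by (rule sum_count_set) auto
  ultimately show ?thesis by (intro exI[of _ e]) (simp add: k e)
qed

lemma prod_list_if_member:
  "is \<noteq> [] \<Longrightarrow> (\<Prod>i\<leftarrow>is. if c then x i else 0) = (if c then \<Prod>i\<leftarrow>is. x i else (0::'a::comm_semiring_1))"
  by (cases "is") auto

text \<open>A monomial of degree \<open>k\<close> is a product of \<open>k\<close> coordinates. With
  at least one factor, cutting off each coordinate outside \<open>X\<close> amounts to cutting off
  the product; the empty product would be 1 there.\<close>

lemma coord_ring_part_eq:
  fixes X :: "('i \<Rightarrow> 'a::field) set"
  assumes "0 < k"
  shows "coord_ring_part I X k = homogeneous_span (\<lambda>i x. if x \<in> X then x i else 0) I k"
proof
  have lp: "list_product (\<lambda>i x. if x \<in> X then x i else 0) is = (\<lambda>x. if x \<in> X then \<Prod>i\<leftarrow>is. x i else 0)"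
    if "length is = k" for "is"
  proof -
    have "is \<noteq> []" using that assms by auto
    from prod_list_if_member[OF this] show ?thesis by (simp only: list_product_def fun_eq_iff) blast
  qed
  show "coord_ring_part I X k \<subseteq> homogeneous_span (\<lambda>i x. if x \<in> X then x i else 0) I k"
  proof
    fix f assume "f \<in> coord_ring_part I X k"
    then obtain p where p: "p \<in> forms I k" and f: "f = (\<lambda>x. if x \<in> X then eval_mpoly p x else 0)"
      by (auto simp: coord_ring_part_def)
    define g where "g e x = (if x \<in> X then \<Prod>i\<in>Poly_Mapping.keys e. x i ^ Poly_Mapping.lookup e i else 0)"
      for e :: "'i \<Rightarrow>\<^sub>0 nat" and x :: "'i \<Rightarrow> 'a"
    have "g e \<in> homogeneous_span (\<lambda>i x. if x \<in> X then x i else 0) I k" if e: "e \<in> Poly_Mapping.keys p" for e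
    proof -
      obtain "is" where "is": "set is \<subseteq> Poly_Mapping.keys e"
        "length is = (\<Sum>i\<in>Poly_Mapping.keys e. Poly_Mapping.lookup e i)"
        "\<forall>x :: 'i \<Rightarrow> 'a. (\<Prod>i\<leftarrow>is. x i) = (\<Prod>i\<in>Poly_Mapping.keys e. x i ^ Poly_Mapping.lookup e i)"
        using monomial_as_list_product[OF finite_keys, of e "Poly_Mapping.lookup e", where ?'a = 'a]
        by (elim exE conjE)
      have "set is \<subseteq> I" "length is = k" using "is" p e by (auto simp: forms_def mpolys_def)
      moreover have "g e = list_product (\<lambda>i x. if x \<in> X then x i else 0) is"
        unfolding lp[OF \<open>length is = k\<close>] using "is"(3) by (simp add: g_def fun_eq_iff)
      ultimately show ?thesis unfolding homogeneous_span_def by (intro fun_vs.span_base) auto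
    qed
    then have "(\<Sum>e\<in>Poly_Mapping.keys p. fun_scale (Poly_Mapping.lookup p e) (g e))
        \<in> homogeneous_span (\<lambda>i x. if x \<in> X then x i else 0) I k"
      unfolding homogeneous_span_def by (intro fun_vs.span_sum fun_vs.span_scale) auto
    also have "(\<Sum>e\<in>Poly_Mapping.keys p. fun_scale (Poly_Mapping.lookup p e) (g e)) = f"
      by (auto simp: f fun_eq_iff sum_apply fun_scale_def g_def eval_mpoly_def)
    finally show "f \<in> homogeneous_span (\<lambda>i x. if x \<in> X then x i else 0) I k" .
  qed
  show "homogeneous_span (\<lambda>i x. if x \<in> X then x i else 0) I k \<subseteq> coord_ring_part I X k"
    unfolding homogeneous_span_def
  proof (intro fun_vs.span_minimal subspace_coord_ring_part image_subsetI)
    fix "is" :: "'i list" assume "is \<in> {is. set is \<subseteq> I \<and> length is = k}"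
    then have "is": "set is \<subseteq> I" "length is = k" by auto
    obtain e where e: "Poly_Mapping.keys e = set is"
      "(\<Sum>i\<in>Poly_Mapping.keys e. Poly_Mapping.lookup e i) = length is"
      "\<forall>x :: 'i \<Rightarrow> 'a. (\<Prod>i\<in>Poly_Mapping.keys e. x i ^ Poly_Mapping.lookup e i) = (\<Prod>i\<leftarrow>is. x i)"
      using list_product_as_monomial[of "is", where ?'a = 'a] by (elim exE conjE)
    have "Poly_Mapping.single e (1 :: 'a) \<in> forms I k"
      using e(1,2) "is" by (auto simp: forms_def mpolys_def)
    moreover have "list_product (\<lambda>i x. if x \<in> X then x i else 0) is
      = (\<lambda>x. if x \<in> X then eval_mpoly (Poly_Mapping.single e 1) x else 0)"
      unfolding lp[OF "is"(2)] using e(3) by (simp add: eval_mpoly_def fun_eq_iff)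
    ultimately show "list_product (\<lambda>i x. if x \<in> X then x i else 0) is \<in> coord_ring_part I X k"
      unfolding coord_ring_part_def by auto
  qed
qed


section \<open>Standard monomials\<close>

text \<open>Read as intervals, two pairs are incomparable exactly when one lies inside the other
  with no common endpoint.\<close>

definition pair_le :: "nat \<times> nat \<Rightarrow> nat \<times> nat \<Rightarrow> bool" where
  "pair_le p q \<longleftrightarrow> fst p \<le> fst q \<and> snd p \<le> snd q"

text \<open>The largest pair comes first, so the head bounds the rest; this gives a recursion over
  the length with the bounds \<open>i, j\<close> as parameters.\<close>

definition standard_lists :: "nat \<Rightarrow> nat \<Rightarrow> nat \<Rightarrow> (nat \<times> nat) list set" where
  "standard_lists i j k = {qs. length qs = k \<and> (\<forall>(a, b)\<in>set qs. a < b \<and> a \<le> i \<and> b \<le> j) \<and>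
     sorted_wrt (\<lambda>p q. pair_le q p) qs}"

lemma standard_lists_0: "standard_lists i j 0 = {[]}"
  by (auto simp: standard_lists_def)

lemma standard_lists_Suc:
  "standard_lists i j (Suc k) =
    (\<Union>p\<in>(SIGMA a:{..i}. {a<..j}). (#) p ` standard_lists (fst p) (snd p) k)" (is "?L = ?R")
proof
  show "?L \<subseteq> ?R"
  proof
    fix ps assume "ps \<in> ?L"
    then obtain a b qs where "ps = (a, b) # qs" "a < b" "a \<le> i" "b \<le> j" "qs \<in> standard_lists a b k"
      by (cases ps) (fastforce simp: standard_lists_def pair_le_def)+
    then show "ps \<in> ?R" by (intro UN_I[of "(a, b)"]) auto
  qed
  show "?R \<subseteq> ?L"
    by (fastforce simp: standard_lists_def pair_le_def)
qed

lemma finite_standard_lists: "finite (standard_lists i j k)"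
  by (induction k arbitrary: i j) (auto simp: standard_lists_0 standard_lists_Suc)

lemma card_standard_lists_Suc:
  "card (standard_lists i j (Suc k)) = (\<Sum>a\<le>i. \<Sum>b\<in>{a<..j}. card (standard_lists a b k))"
proof -
  have "card (standard_lists i j (Suc k))
      = (\<Sum>p\<in>(SIGMA a:{..i}. {a<..j}). card ((#) p ` standard_lists (fst p) (snd p) k))"
    unfolding standard_lists_Suc by (intro card_UN_disjoint) (auto simp: finite_standard_lists)
  also have "\<dots> = (\<Sum>p\<in>(SIGMA a:{..i}. {a<..j}). card (standard_lists (fst p) (snd p) k))"
    by (intro sum.cong refl card_image) auto
  also have "\<dots> = (\<Sum>a\<le>i. \<Sum>b\<in>{a<..j}. card (standard_lists a b k))"
    by (subst sum.Sigma) (auto simp: case_prod_unfold)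
  finally show ?thesis .
qed

text \<open>The outer summation, by the hockey-stick identity for binomial coefficients. The inner
  sum is a hypothesis because it is computed differently for \<open>k = 0\<close> and in the
  induction step.\<close>

lemma card_standard_lists_step:
  assumes "i \<le> j"
    and inner: "\<And>a. a \<le> j \<Longrightarrow> (\<Sum>b\<in>{a<..j}. int (card (standard_lists a b k))) =
      int ((a + k) choose k) * int ((j + k) choose (k + 1)) - int ((a + k) choose (k + 1)) * int ((j + k) choose k)"
  shows "int (card (standard_lists i j (Suc k))) =
    int ((i + k + 1) choose (k + 1)) * int ((j + k) choose (k + 1))
    - int ((i + k + 1) choose (k + 2)) * int ((j + k) choose k)"
proof -
  have "int (card (standard_lists i j (Suc k))) = (\<Sum>a\<le>i. int ((a + k) choose k) * int ((j + k) choose (k + 1))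
      - int ((a + k) choose (k + 1)) * int ((j + k) choose k))"
    using assms(1) by (simp add: card_standard_lists_Suc inner)
  also have "\<dots> = int ((i + k + 1) choose (k + 1)) * int ((j + k) choose (k + 1))
    - int ((i + k + 1) choose (k + 2)) * int ((j + k) choose k)"
    by (induction i) (simp_all add: algebra_simps)
  finally show ?thesis .
qed

lemma card_standard_lists:
  assumes "i \<le> j"
  shows "int (card (standard_lists i j (Suc k))) =
    int ((i + k + 1) choose (k + 1)) * int ((j + k) choose (k + 1))
    - int ((i + k + 1) choose (k + 2)) * int ((j + k) choose k)"
  using assms
proof (induction k arbitrary: i j)
  case (0 i j)
  show ?case
    by (rule card_standard_lists_step[OF 0]) (simp add: standard_lists_0)
next
  case (Suc k i j)
  show ?case
  proof (rule card_standard_lists_step[OF Suc.prems])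
    fix a assume "a \<le> j"
    then show "(\<Sum>b\<in>{a<..j}. int (card (standard_lists a b (Suc k)))) =
      int ((a + Suc k) choose Suc k) * int ((j + Suc k) choose (Suc k + 1))
      - int ((a + Suc k) choose (Suc k + 1)) * int ((j + Suc k) choose Suc k)"
    \<comment> \<open>At \<open>j = a\<close> the two products cancel. By Pascal's rule the
      increment from \<open>j\<close> to \<open>j + 1\<close> is the count that the outer induction
      hypothesis gives for the bounds \<open>a\<close> and \<open>j + 1\<close>.\<close>
    proof (induction j rule: dec_induct)
      case (step j)
      then have "{a<..Suc j} = insert (Suc j) {a<..j}" by auto
      then have "(\<Sum>b\<in>{a<..Suc j}. int (card (standard_lists a b (Suc k)))) =
          int (card (standard_lists a (Suc j) (Suc k))) + (\<Sum>b\<in>{a<..j}. int (card (standard_lists a b (Suc k))))"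
        by simp
      then show ?case
        unfolding step.IH using Suc.IH[of a "Suc j"] step.hyps by (simp add: algebra_simps)
    qed (simp add: algebra_simps)
  qed
qed

lemma list_product_cong_mset:
  assumes "mset ps = mset qs" shows "list_product f ps = list_product f qs"
proof -
  have "list_product f rs x = prod_mset (image_mset (\<lambda>i. f i x) (mset rs))" for rs x
    by (simp add: list_product_def prod_mset_prod_list[symmetric])
  then show ?thesis using assms by (simp add: fun_eq_iff)
qed

text \<open>The Pluecker relation replaces a nested pair of intervals by pairs that are not nested,
  which decreases the sum of the squared lengths.\<close>

lemma straightening:
  fixes f :: "nat \<times> nat \<Rightarrow> 'x \<Rightarrow> 'a::field"
  assumes rel: "\<And>a b c d x. a < b \<Longrightarrow> b < c \<Longrightarrow> c < d \<Longrightarrow> d \<le> m \<Longrightarrow>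
      f (a, d) x * f (b, c) x = f (a, c) x * f (b, d) x - f (a, b) x * f (c, d) x"
    and "set qs \<subseteq> plucker_index m"
  shows "list_product f qs \<in> fun_vs.span (list_product f ` standard_lists m m (length qs))"
  using assms(2)
proof (induction "\<Sum>(a, b)\<leftarrow>qs. (b - a)\<^sup>2" arbitrary: qs rule: less_induct)
  case less
  show ?case
  proof (cases "\<forall>p\<in>set qs. \<forall>q\<in>set qs. pair_le p q \<or> pair_le q p")
    case True
    \<comment> \<open>On pairwise comparable pairs, sorting by \<open>a + b\<close> produces a
      chain; the reversal puts the largest pair first.\<close>
    define rs where "rs = rev (sort_key (\<lambda>(a, b). a + b) qs)"
    have "sorted_wrt (\<lambda>p q. (case p of (a, b) \<Rightarrow> a + b) \<le> (case q of (a, b) \<Rightarrow> a + b))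
        (sort_key (\<lambda>(a, b). a + b) qs)"
      using sorted_sort_key[of "\<lambda>(a, b). a + b" qs] by (simp add: sorted_map)
    then have "sorted_wrt pair_le (sort_key (\<lambda>(a, b). a + b) qs)"
      by (rule sorted_wrt_mono_rel[rotated]) (use True in \<open>fastforce simp: pair_le_def\<close>)
    then have sorted: "sorted_wrt (\<lambda>p q. pair_le q p) rs" by (simp add: rs_def sorted_wrt_rev)
    have mset: "mset rs = mset qs" by (simp add: rs_def)
    have "\<forall>(a, b)\<in>set rs. a < b \<and> a \<le> m \<and> b \<le> m"
      unfolding mset_eq_setD[OF mset] using less.prems by (auto simp: plucker_index_def)
    with sorted mset_eq_length[OF mset] have "rs \<in> standard_lists m m (length qs)"
      unfolding standard_lists_def by (intro CollectI conjI)
    then show ?thesis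
      unfolding list_product_cong_mset[OF mset, of f, symmetric] by (intro fun_vs.span_base imageI)
  next
    case False
    then obtain a b c d where ad: "(a, d) \<in> set qs" and bc: "(b, c) \<in> set qs" and "a < b" "c < d"
      by (auto simp: pair_le_def not_le)
    moreover have "b < c" "d \<le> m" using ad bc less.prems by (auto simp: plucker_index_def)
    ultimately have lt: "a < b" "b < c" "c < d" "d \<le> m" by auto
    define ts where "ts = remove1 (a, d) qs"
    define rs where "rs = remove1 (b, c) ts"
    have "(b, c) \<in> set ts" using bc \<open>a < b\<close> by (simp add: ts_def)
    then have "mset ts = add_mset (b, c) (mset rs)" by (simp add: rs_def)
    moreover have "mset qs = add_mset (a, d) (mset ts)" using ad by (simp add: ts_def)
    ultimately have mset: "mset qs = mset ((a, d) # (b, c) # rs)" by simp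
    have rs: "set rs \<subseteq> plucker_index m" "length qs = Suc (Suc (length rs))"
      using less.prems mset_eq_setD[OF mset] mset_eq_length[OF mset] by auto
    have sm: "(\<Sum>(a, b)\<leftarrow>qs. (b - a)\<^sup>2) = (d - a)\<^sup>2 + (c - b)\<^sup>2 + (\<Sum>(a, b)\<leftarrow>rs. (b - a)\<^sup>2)"
    proof -
      have "(\<Sum>(a, b)\<leftarrow>ps. (b - a)\<^sup>2) = sum_mset (image_mset (\<lambda>(a, b). (b - a)\<^sup>2) (mset ps))"
        for ps :: "(nat \<times> nat) list"
        by (simp add: sum_mset_sum_list[symmetric])
      then show ?thesis by (simp add: mset)
    qed
    obtain x y z where xyz: "b = a + Suc x" "c = b + Suc y" "d = c + Suc z"
      using lt less_imp_Suc_add by (metis add_Suc_right)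
    have dec1: "(c - a)\<^sup>2 + (d - b)\<^sup>2 < (d - a)\<^sup>2 + (c - b)\<^sup>2"
      and dec2: "(b - a)\<^sup>2 + (d - c)\<^sup>2 < (d - a)\<^sup>2 + (c - b)\<^sup>2"
      by (simp_all add: xyz power2_eq_square algebra_simps)
    have *: "list_product f ((a, c) # (b, d) # rs) \<in> fun_vs.span (list_product f ` standard_lists m m (length qs))"
      using less.hyps[of "(a, c) # (b, d) # rs"] dec1 lt rs by (auto simp: sm plucker_index_def)
    have **: "list_product f ((a, b) # (c, d) # rs) \<in> fun_vs.span (list_product f ` standard_lists m m (length qs))"
      using less.hyps[of "(a, b) # (c, d) # rs"] dec2 lt rs by (auto simp: sm plucker_index_def)
    have "list_product f qs = list_product f ((a, d) # (b, c) # rs)"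
      by (rule list_product_cong_mset[OF mset])
    also have "\<dots> = list_product f ((a, c) # (b, d) # rs) - list_product f ((a, b) # (c, d) # rs)"
      using rel[OF lt] by (simp add: list_product_Cons fun_eq_iff mult.assoc[symmetric] left_diff_distrib)
    finally show ?thesis using fun_vs.span_diff[OF * **] by simp
  qed
qed

section \<open>Linear independence through leading exponents\<close>

lemma digits_unique:
  fixes K :: nat
  assumes "\<And>l. d l < K" "\<And>l. e l < K" "(\<Sum>l<n. d l * K ^ l) = (\<Sum>l<n. e l * K ^ l)" "l < n"
  shows "d l = e l"
  using assms
proof (induction n arbitrary: d e l)
  case (Suc n)
  have sh: "(\<Sum>l<Suc n. g l * K ^ l) = g 0 + K * (\<Sum>l<n. g (Suc l) * K ^ l)" for g
    by (simp add: sum.lessThan_Suc_shift sum_distrib_left mult.left_commute del: sum.lessThan_Suc)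
  have eq: "d 0 + K * (\<Sum>l<n. d (Suc l) * K ^ l) = e 0 + K * (\<Sum>l<n. e (Suc l) * K ^ l)"
    using Suc.prems(3) by (simp only: sh)
  from arg_cong[OF eq, of "\<lambda>s. s mod K"] have 0: "d 0 = e 0"
    using Suc.prems(1)[of 0] Suc.prems(2)[of 0] by simp
  have "0 < K" using Suc.prems(1)[of 0] by simp
  then have "(\<Sum>l<n. d (Suc l) * K ^ l) = (\<Sum>l<n. e (Suc l) * K ^ l)" using eq 0 by simp
  then have "d (Suc l) = e (Suc l)" if "l < n" for l
    using Suc.IH[of "\<lambda>l. d (Suc l)" "\<lambda>l. e (Suc l)" l] Suc.prems(1,2) that by simp
  then show ?case using 0 Suc.prems(4) by (cases l) auto
qed simp

text \<open>A multiplicity is at most the length of the list, hence below \<open>K\<close>, so the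
  multiplicities are the base \<open>K\<close> digits of the sum.\<close>

lemma sum_list_powers_determine_mset:
  fixes K :: nat
  assumes "length xs < K" "length ys < K" "(\<Sum>l\<leftarrow>xs. K ^ l) = (\<Sum>l\<leftarrow>ys. K ^ l)"
  shows "mset xs = mset ys"
proof -
  obtain n where n: "set xs \<subseteq> {..<n}" "set ys \<subseteq> {..<n}"
    using finite_nat_iff_bounded[of "set xs \<union> set ys"] by auto
  have e: "(\<Sum>l\<leftarrow>zs. K ^ l) = (\<Sum>l<n. count_list zs l * K ^ l)" if "set zs \<subseteq> {..<n}" for zs
    using that sum_list_map_eq_sum_count2[of zs "{..<n}" "\<lambda>l. K ^ l"] by simp
  have "count_list xs l = count_list ys l" for l
  proof (cases "l < n")
    case True
    show ?thesis
      by (rule digits_unique[where K = K and n = n and d = "count_list xs" and e = "count_list ys"])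
         (use assms n e True in \<open>auto intro: le_less_trans[OF count_le_length]\<close>)
  next
    case False
    then show ?thesis using n by (metis count_list_0_iff lessThan_iff subsetD)
  qed
  then show ?thesis by (simp add: multiset_eq_iff count_mset)
qed

text \<open>The exponent of \<open>t\<close> in \<open>u a * v b\<close> on the test curve. For
  \<open>a, b \<le> m\<close> the exponents \<open>m - a\<close> and \<open>m + 1 + b\<close> lie in
  disjoint ranges, so the two indices can be told apart. The first falls with \<open>a\<close> and
  the second grows with \<open>b\<close>, so that \<open>u a * v b\<close> dominates
  \<open>u b * v a\<close> for \<open>a < b\<close>.\<close>

definition weight :: "nat \<Rightarrow> nat \<Rightarrow> nat \<times> nat \<Rightarrow> nat" where
  "weight K m = (\<lambda>(a, b). K ^ (m - a) + K ^ (m + 1 + b))"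

text \<open>The sum consists of \<open>2 * k\<close> powers of \<open>K\<close>, so its digits give
  the multisets of first and of second components. Both components are sorted along a standard list,
  which is thereby recovered.\<close>

lemma inj_on_weight:
  assumes "2 * k < K"
  shows "inj_on (\<lambda>qs. \<Sum>q\<leftarrow>qs. weight K m q) (standard_lists m m k)"
proof (rule inj_onI)
  fix ps qs assume ps: "ps \<in> standard_lists m m k" and qs: "qs \<in> standard_lists m m k"
    and eq: "(\<Sum>q\<leftarrow>ps. weight K m q) = (\<Sum>q\<leftarrow>qs. weight K m q)"
  define E where "E rs = map (\<lambda>q. m - fst q) rs @ map (\<lambda>q. m + 1 + snd q) rs" for rs :: "(nat \<times> nat) list"
  have "(\<Sum>l\<leftarrow>E rs. K ^ l) = (\<Sum>q\<leftarrow>rs. weight K m q)" for rs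
    by (induction rs) (auto simp: E_def weight_def)
  then have "mset (E ps) = mset (E qs)"
    using ps qs assms eq by (intro sum_list_powers_determine_mset[of _ K]) (auto simp: E_def standard_lists_def)
  then have mE: "mset (filter P (E ps)) = mset (filter P (E qs))" for P by (simp add: mset_filter)
  have f1: "filter (\<lambda>l. l \<le> m) (E rs) = map (\<lambda>q. m - fst q) rs"
    and f2: "filter (\<lambda>l. m < l) (E rs) = map (\<lambda>q. m + 1 + snd q) rs" for rs
    by (auto simp: E_def filter_map comp_def filter_empty_conv)
  have fst: "map fst rs = map (\<lambda>l. m - l) (map (\<lambda>q. m - fst q) rs)"
    if "rs \<in> standard_lists m m k" for rs
    using that by (auto simp: standard_lists_def)
  have snd: "map snd rs = map (\<lambda>l. l - m - 1) (map (\<lambda>q. m + 1 + snd q) rs)" for rs :: "(nat \<times> nat) list"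
    by auto
  have m1: "mset (map fst ps) = mset (map fst qs)"
    unfolding fst[OF ps] fst[OF qs] using mE[of "\<lambda>l. l \<le> m"] unfolding f1 by (metis mset_map)
  have m2: "mset (map snd ps) = mset (map snd qs)"
    unfolding snd[of ps] snd[of qs] using mE[of "\<lambda>l. m < l"] unfolding f2 by (metis mset_map)
  have sorted: "sorted (rev (map fst rs))" "sorted (rev (map snd rs))"
    if "rs \<in> standard_lists m m k" for rs
    using that by (auto simp: standard_lists_def pair_le_def sorted_wrt_rev sorted_wrt_map
        simp del: rev_map elim!: sorted_wrt_mono_rel[rotated])
  have "rev (map fst ps) = rev (map fst qs)" "rev (map snd ps) = rev (map snd qs)"
    using properties_for_sort[OF _ sorted(1)[OF ps], of "rev (map fst qs)"] sorted(1)[OF qs] m1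
      properties_for_sort[OF _ sorted(2)[OF ps], of "rev (map snd qs)"] sorted(2)[OF qs] m2
    by (simp_all add: sorted_sort_id)
  then have "map fst ps = map fst qs" "map snd ps = map snd qs" by simp_all
  then show "ps = qs" by (metis zip_map_fst_snd)
qed

text \<open>The highest degree that occurs with a nonzero coefficient occurs only once, so its
  leading term cannot cancel.\<close>

lemma sum_smult_distinct_degrees:
  fixes P :: "'b \<Rightarrow> 'a::idom poly"
  assumes "finite S" "inj_on (\<lambda>s. degree (P s)) S" "\<And>s. s \<in> S \<Longrightarrow> P s \<noteq> 0"
    and sum: "(\<Sum>s\<in>S. smult (c s) (P s)) = 0" and "s \<in> S"
  shows "c s = 0"
proof (rule ccontr)
  assume "c s \<noteq> 0"
  define T where "T = {s \<in> S. c s \<noteq> 0}"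
  have T: "finite T" "T \<noteq> {}" using assms \<open>c s \<noteq> 0\<close> by (auto simp: T_def)
  define d where "d = Max ((\<lambda>s. degree (P s)) ` T)"
  have "d \<in> (\<lambda>s. degree (P s)) ` T" unfolding d_def using T by (intro Max_in) auto
  then obtain t where t: "t \<in> T" "degree (P t) = d" by auto
  have "coeff (smult (c s) (P s)) d = (if s = t then c t * lead_coeff (P t) else 0)" if s: "s \<in> S" for s
  proof (cases "s \<in> T \<and> s \<noteq> t")
    case True
    have "degree (P s) \<le> d" unfolding d_def using T True by (intro Max_ge) auto
    moreover have "degree (P s) \<noteq> d" using inj_onD[OF assms(2), of s t] True t s by (auto simp: T_def)
    ultimately show ?thesis using True by (simp add: coeff_eq_0)
  next
    case False
    then show ?thesis using t s by (auto simp: T_def)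
  qed
  then have "coeff (\<Sum>s\<in>S. smult (c s) (P s)) d = (\<Sum>s\<in>S. if s = t then c t * lead_coeff (P t) else 0)"
    by (simp add: coeff_sum)
  also have "\<dots> = c t * lead_coeff (P t)" using t assms(1) by (simp add: T_def)
  finally show False using sum t assms(3) by (auto simp: T_def)
qed

text \<open>A linear relation among the functions restricts to the curve \<open>x\<close>, where it
  becomes a relation among polynomials of distinct degrees.\<close>

lemma independent_distinct_degrees:
  fixes g :: "'b \<Rightarrow> 'x \<Rightarrow> 'a::field_char_0"
  assumes fin: "finite S" and inj: "inj_on (\<lambda>s. degree (P s)) S" and nz: "\<And>s. s \<in> S \<Longrightarrow> P s \<noteq> 0"
    and g: "\<And>s t. s \<in> S \<Longrightarrow> g s (x t) = poly (P s) t"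
  shows "inj_on g S" "fun_vs.independent (g ` S)"
proof -
  show inj_g: "inj_on g S"
  proof (rule inj_onI)
    fix s t assume st: "s \<in> S" "t \<in> S" "g s = g t"
    then have "poly (P s) = poly (P t)" using g by (metis ext)
    then show "s = t" using inj st by (auto simp: poly_eq_poly_eq_iff inj_on_def)
  qed
  show "fun_vs.independent (g ` S)"
  proof
    assume "fun_vs.dependent (g ` S)"
    then obtain c s where c: "(\<Sum>v\<in>g ` S. fun_scale (c v) v) = 0" and s: "s \<in> S" "c (g s) \<noteq> 0"
      using fin by (auto simp: fun_vs.dependent_finite)
    have "(\<Sum>s\<in>S. fun_scale (c (g s)) (g s)) = 0"
      using c by (simp add: sum.reindex[OF inj_g] comp_def)
    from fun_cong[OF this] have "(\<Sum>s\<in>S. c (g s) * g s (x t)) = 0" for t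
      by (simp add: sum_apply fun_scale_def)
    then have "poly (\<Sum>s\<in>S. smult (c (g s)) (P s)) = poly 0"
      by (simp add: fun_eq_iff poly_sum g)
    then have "(\<Sum>s\<in>S. smult (c (g s)) (P s)) = 0" by (simp only: poly_eq_poly_eq_iff)
    from sum_smult_distinct_degrees[OF fin inj nz this s(1)] s(2) show False by simp
  qed
qed


section \<open>The variety of inverse Hankel matrices\<close>

lemma homogeneous_span_one:
  assumes "g \<in> fun_vs.span (f ` I)" shows "g \<in> homogeneous_span f I 1"
proof -
  have "list_product f [] \<in> homogeneous_span f I 0"
    unfolding homogeneous_span_def by (intro fun_vs.span_base imageI) simp
  from homogeneous_span_mult[OF assms this] show ?thesis by (simp add: list_product_Nil)
qed

lemma inverse_variety_subset: "inverse_variety m L \<subseteq> coord_space (sym_index m)"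
  by (auto simp: inverse_variety_def zariski_closure_def)

text \<open>The Pluecker relations are quadratic in the matrix entries and hold on the inverses of
  Hankel matrices, hence on the Zariski closure.\<close>

lemma inverse_variety_decomposable:
  fixes x :: "nat \<times> nat \<Rightarrow> 'a::field"
  assumes m: "0 < m" and x: "x \<in> inverse_variety m (hankel_mats m)"
  shows "\<exists>u v. bez_map m x = plucker m u v"
proof (rule bez_map_decomposableI)
  let ?C = "coord_space (sym_index m) :: (nat \<times> nat \<Rightarrow> 'a) set"
  show xC: "x \<in> ?C" using x inverse_variety_subset by blast
  fix a b c d assume le: "a \<le> m" "b \<le> m" "c \<le> m" "d \<le> m"
  \<comment> \<open>Functions are cut off outside the coordinate space to fit
    \<open>coord_ring_part\<close>. A quadratic form representing the relation is then obtained from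
    span arguments instead of being written down.\<close>
  define f where "f s y = (if y \<in> ?C then y s else 0)" for s and y :: "nat \<times> nat \<Rightarrow> 'a"
  let ?S = "fun_vs.span (f ` sym_index m)"
  have coord: "f s \<in> ?S" for s
  proof (cases "s \<in> sym_index m")
    case False
    then have "f s = 0" by (auto simp: f_def fun_eq_iff coord_space_zero)
    then show ?thesis by (simp add: fun_vs.span_zero)
  qed (auto intro: fun_vs.span_base)
  have entry: "(\<lambda>y. if y \<in> ?C then sym_entry y i j else 0) \<in> ?S" for i j
  proof -
    have "(\<lambda>y. if y \<in> ?C then sym_entry y i j else 0) = (if i \<le> j then f (i, j) else f (j, i))"
      by (auto simp: sym_entry_def f_def)
    then show ?thesis using coord by simp
  qed
  define D where "D i j y = (if y \<in> ?C then disp y i j else 0)" for i j and y :: "nat \<times> nat \<Rightarrow> 'a"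
  have D: "D i j \<in> ?S" for i j
  proof -
    define p where "p = (if j = 0 then 0 else (\<lambda>y. if y \<in> ?C then sym_entry y i (j - 1) else 0))"
    define q where "q = (if i = 0 then 0 else (\<lambda>y. if y \<in> ?C then sym_entry y (i - 1) j else 0))"
    have "p \<in> ?S" "q \<in> ?S" using entry by (simp_all add: p_def q_def fun_vs.span_zero)
    then have "p - q \<in> ?S" by (rule fun_vs.span_diff)
    moreover have "p - q = D i j" by (auto simp: p_def q_def D_def disp_def fun_eq_iff)
    ultimately show ?thesis by simp
  qed
  have DD: "(\<lambda>y. D i j y * D k l y) \<in> homogeneous_span f (sym_index m) 2" for i j k l
    using homogeneous_span_mult[OF D homogeneous_span_one[OF D], of i j k l] by (simp add: numeral_2_eq_2)
  define R where "R = (\<lambda>y. D a b y * D c d y) - (\<lambda>y. D a c y * D b d y) + (\<lambda>y. D a d y * D b c y)"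
  have "R \<in> homogeneous_span f (sym_index m) 2"
    unfolding R_def homogeneous_span_def
    by (intro fun_vs.span_add fun_vs.span_diff DD[unfolded homogeneous_span_def])
  also have "\<dots> = coord_ring_part (sym_index m) ?C 2"
    by (simp add: coord_ring_part_eq f_def[abs_def])
  finally obtain p where p: "p \<in> forms (sym_index m) 2" and R: "R = (\<lambda>y. if y \<in> ?C then eval_mpoly p y else 0)"
    unfolding coord_ring_part_def by blast
  have R_eq: "R y = disp y a b * disp y c d - disp y a c * disp y b d + disp y a d * disp y b c"
    if "y \<in> ?C" for y using that by (simp add: R_def D_def)
  have "eval_mpoly p y = 0" if y: "y \<in> sym_coords m ` inverse_mats m (hankel_mats m)" for y
  proof -
    have yC: "y \<in> ?C" using y sym_coords_coord_space by blast
    obtain u v where "bez_map m y = plucker m u v" using y inverse_hankel_decomposable[OF m] by blast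
    then have "R y = 0" unfolding R_eq[OF yC] using le by (rule disp_plucker_relation[OF yC])
    then show ?thesis using yC by (simp add: R)
  qed
  then have "eval_mpoly p x = 0"
    using x p by (auto simp: inverse_variety_def zariski_closure_def forms_def)
  then show "disp x a b * disp x c d - disp x a c * disp x b d + disp x a d * disp x b c = 0"
    using R_eq[OF xC] xC by (simp add: R)
qed

lemma inverse_variety_eq:
  assumes "0 < m"
  shows "inverse_variety m (hankel_mats m) = {x \<in> coord_space (sym_index m).
    \<exists>u v :: nat \<Rightarrow> 'a::field_char_0. bez_map m x = plucker m u v}"
  using inverse_variety_decomposable[OF assms] inverse_variety_subset
    decomposable_in_inverse_variety[OF _ assms] by blast

lemma bez_map_inverse_variety:
  assumes "0 < m"
  shows "bez_map m ` inverse_variety m (hankel_mats m) = (grassmannian_cone m :: (_ \<Rightarrow> 'a::field_char_0) set)"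
proof
  show "bez_map m ` inverse_variety m (hankel_mats m) \<subseteq> (grassmannian_cone m :: (_ \<Rightarrow> 'a) set)"
    by (auto simp: inverse_variety_eq[OF assms] grassmannian_cone_eq[OF assms])
  show "grassmannian_cone m \<subseteq> bez_map m ` inverse_variety m (hankel_mats m :: 'a mat set)"
  proof
    fix y :: "nat \<times> nat \<Rightarrow> 'a" assume "y \<in> grassmannian_cone m"
    then obtain u v where y: "y = plucker m u v" by (auto simp: grassmannian_cone_eq[OF assms])
    have "bez_map m (bez_inv m y) = y" by (simp add: y bez_map_bez_inv plucker_coord_space)
    then show "y \<in> bez_map m ` inverse_variety m (hankel_mats m)"
      using bez_inv_coord_space[of m y] y unfolding inverse_variety_eq[OF assms] by (metis (mono_tags, lifting) image_eqI mem_Collect_eq)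
  qed
qed

text \<open>The Pluecker coordinates are linear combinations of the matrix entries and, through
  \<open>bez_inv\<close>, conversely; so both generate the same functions in each degree.\<close>

lemma homogeneous_span_bez_map:
  fixes X :: "(nat \<times> nat \<Rightarrow> 'a::field) set"
  assumes X: "X \<subseteq> coord_space (sym_index m)"
  shows "homogeneous_span (\<lambda>q x. if x \<in> X then bez_map m x q else 0) (plucker_index m) k
    = homogeneous_span (\<lambda>i x. if x \<in> X then x i else 0) (sym_index m) k"
proof (rule homogeneous_span_eq)
  define f where "f i x = (if x \<in> X then x i else 0)" for i and x :: "nat \<times> nat \<Rightarrow> 'a"
  define g where "g q x = (if x \<in> X then bez_map m x q else 0)" for q x
  have "g q \<in> fun_vs.span (f ` sym_index m)" if "q \<in> plucker_index m" for q
  proof -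
    have "g q = (\<Sum>i\<in>sym_index m. fun_scale (bez_coeff q i) (f i))"
      using that by (auto simp: g_def f_def fun_eq_iff sum_apply fun_scale_def lin_map_def)
    also have "\<dots> \<in> fun_vs.span (f ` sym_index m)"
      by (intro fun_vs.span_sum fun_vs.span_scale fun_vs.span_base imageI)
    finally show ?thesis .
  qed
  then show "(\<lambda>q x. if x \<in> X then bez_map m x q else 0) ` plucker_index m
      \<subseteq> fun_vs.span ((\<lambda>i x. if x \<in> X then x i else 0) ` sym_index m)"
    unfolding g_def f_def by blast
  have g: "g q \<in> fun_vs.span (g ` plucker_index m)" for q
  proof (cases "q \<in> plucker_index m")
    case False
    then have "g q = 0" by (auto simp: g_def fun_eq_iff bez_map_outside)
    then show ?thesis by (simp add: fun_vs.span_zero)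
  qed (auto intro: fun_vs.span_base)
  have "f (i, j) \<in> fun_vs.span (g ` plucker_index m)" if "(i, j) \<in> sym_index m" for i j
  proof -
    have "x (i, j) = (\<Sum>l\<le>i. bez_map m x (i - l, j + 1 + l))" if "x \<in> X" for x
      using fun_cong[OF bez_inv_bez_map, of x m "(i, j)"] X that \<open>(i, j) \<in> sym_index m\<close>
      by (auto simp: bez_inv_def)
    then have "f (i, j) = (\<Sum>l\<le>i. g (i - l, j + 1 + l))"
      by (auto simp: f_def g_def fun_eq_iff sum_apply)
    also have "\<dots> \<in> fun_vs.span (g ` plucker_index m)"
      by (intro fun_vs.span_sum g)
    finally show ?thesis .
  qed
  then show "(\<lambda>i x. if x \<in> X then x i else 0) ` sym_index m
      \<subseteq> fun_vs.span ((\<lambda>q x. if x \<in> X then bez_map m x q else 0) ` plucker_index m)"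
    unfolding g_def f_def by auto
qed

section \<open>The Hilbert function\<close>

text \<open>The Pluecker coordinate \<open>(a, b)\<close> on the test curve, as a polynomial in
  \<open>t\<close>.\<close>

definition minor_poly :: "nat \<Rightarrow> nat \<Rightarrow> nat \<times> nat \<Rightarrow> 'a::comm_ring_1 poly" where
  "minor_poly K m = (\<lambda>(a, b). monom 1 (weight K m (a, b)) - monom 1 (weight K m (b, a)))"

text \<open>Swapping \<open>a\<close> and \<open>b\<close> lowers both powers of \<open>K\<close> in
  the weight, so the first monomial leads.\<close>

lemma minor_poly_degree:
  assumes "2 \<le> K" "a < b" "b \<le> m"
  shows "degree (minor_poly K m (a, b) :: 'a::idom poly) = weight K m (a, b)"
    "lead_coeff (minor_poly K m (a, b) :: 'a::idom poly) = 1"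
proof -
  have "K ^ (m - b) < K ^ (m - a)" "K ^ (m + 1 + a) < K ^ (m + 1 + b)"
    using assms by (auto intro!: power_strict_increasing)
  then have lt: "weight K m (b, a) < weight K m (a, b)"
    unfolding weight_def prod.case by (rule add_strict_mono)
  have 1: "coeff (minor_poly K m (a, b) :: 'a poly) (weight K m (a, b)) = 1"
    using lt by (simp add: minor_poly_def)
  have "degree (minor_poly K m (a, b) :: 'a poly) \<le> weight K m (a, b)"
    using lt by (auto simp: minor_poly_def degree_monom_eq intro!: degree_diff_le)
  moreover have "weight K m (a, b) \<le> degree (minor_poly K m (a, b) :: 'a poly)"
    using 1 by (intro le_degree) simp
  ultimately show "degree (minor_poly K m (a, b) :: 'a poly) = weight K m (a, b)" by simp
  with 1 show "lead_coeff (minor_poly K m (a, b) :: 'a poly) = 1" by simp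
qed

lemma prod_minor_poly_degree:
  assumes "2 \<le> K" "set qs \<subseteq> plucker_index m"
  shows "degree (\<Prod>q\<leftarrow>qs. minor_poly K m q :: 'a::idom poly) = (\<Sum>q\<leftarrow>qs. weight K m q) \<and>
    lead_coeff (\<Prod>q\<leftarrow>qs. minor_poly K m q :: 'a poly) = 1"
  using assms(2)
proof (induction qs)
  case (Cons q qs)
  obtain a b where q: "q = (a, b)" by (cases q)
  then have d: "degree (minor_poly K m q :: 'a poly) = weight K m q" "lead_coeff (minor_poly K m q :: 'a poly) = 1"
    using minor_poly_degree[OF assms(1), of a b m] Cons.prems by (auto simp: plucker_index_def)
  let ?P = "\<Prod>q\<leftarrow>qs. minor_poly K m q :: 'a poly"
  have IH: "degree ?P = (\<Sum>q\<leftarrow>qs. weight K m q)" "lead_coeff ?P = 1" using Cons by auto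
  have nz: "minor_poly K m q \<noteq> (0 :: 'a poly)" "?P \<noteq> 0"
    using d(2) IH(2) by (metis leading_coeff_0_iff zero_neq_one)+
  have "lead_coeff (minor_poly K m q * ?P) = 1"
    unfolding lead_coeff_mult d(2) IH(2) by simp
  moreover have "degree (minor_poly K m q * ?P) = weight K m q + (\<Sum>q\<leftarrow>qs. weight K m q)"
    unfolding degree_mult_eq[OF nz] d(1) IH(1) ..
  ultimately show ?case by (simp only: list.map prod_list.Cons sum_list.Cons)
qed simp

text \<open>The standard monomials form a basis of the degree \<open>k\<close> part: they span by
  straightening, and they are independent because their restrictions to the curve \<open>pt\<close>
  have distinct degrees.\<close>

lemma hilbert_function_inverse_variety:
  assumes m: "0 < m" and k: "0 < k"
  shows "hilbert_function (sym_index m) (inverse_variety m (hankel_mats m :: 'a::field_char_0 mat set)) k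
    = card (standard_lists m m k)"
proof -
  define X where "X = inverse_variety m (hankel_mats m :: 'a mat set)"
  define g where "g q x = (if x \<in> X then bez_map m x q else 0)" for q x
  let ?B = "list_product g ` standard_lists m m k"
  have XC: "X \<subseteq> coord_space (sym_index m)" by (simp add: X_def inverse_variety_subset)
  have ring: "coord_ring_part (sym_index m) X k = homogeneous_span g (plucker_index m) k"
    using coord_ring_part_eq[OF k, of "sym_index m" X] homogeneous_span_bez_map[OF XC]
    by (simp add: g_def[abs_def])
  have std: "set qs \<subseteq> plucker_index m" "length qs = k" if "qs \<in> standard_lists m m k" for qs
    using that by (auto simp: standard_lists_def plucker_index_def)
  \<comment> \<open>A standard list contributes \<open>2 * k\<close> powers of the base, so
    \<open>2 * k + 1\<close> rules out carries.\<close>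
  define K where "K = 2 * k + 1"
  define pt :: "'a \<Rightarrow> nat \<times> nat \<Rightarrow> 'a" where
    "pt t = bez_inv m (plucker m (\<lambda>a. t ^ K ^ (m - a)) (\<lambda>b. t ^ K ^ (m + 1 + b)))" for t
  have bez_pt: "bez_map m (pt t) = plucker m (\<lambda>a. t ^ K ^ (m - a)) (\<lambda>b. t ^ K ^ (m + 1 + b))" for t
    by (simp add: pt_def bez_map_bez_inv plucker_coord_space)
  then have pt: "pt t \<in> X" for t
    unfolding X_def inverse_variety_eq[OF m] using bez_inv_coord_space by (auto simp: pt_def)
  have g_pt: "g q (pt t) = poly (minor_poly K m q) t" if "q \<in> plucker_index m" for q t
    using that pt[of t]
    by (cases q) (simp add: g_def bez_pt plucker_def minor_poly_def weight_def poly_monom power_add mult.commute)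
  have lp: "list_product g qs (pt t) = poly (\<Prod>q\<leftarrow>qs. minor_poly K m q) t" if "set qs \<subseteq> plucker_index m" for qs t
    using that by (induction qs) (auto simp: list_product_Nil list_product_Cons g_pt)
  have K: "2 \<le> K" "2 * k < K" using k by (auto simp: K_def)
  have inj: "inj_on (list_product g) (standard_lists m m k)" and indep: "fun_vs.independent ?B"
  proof -
    let ?P = "\<lambda>qs. \<Prod>q\<leftarrow>qs. minor_poly K m q :: 'a poly"
    have "inj_on (\<lambda>qs. degree (?P qs)) (standard_lists m m k)"
      using inj_on_weight[OF K(2), of m] prod_minor_poly_degree[OF K(1), where ?'a = 'a] std(1)
      by (simp cong: inj_on_cong)
    moreover have "?P qs \<noteq> 0" if "qs \<in> standard_lists m m k" for qs
      using prod_minor_poly_degree[OF K(1) std(1)[OF that], where ?'a = 'a]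
      by (metis leading_coeff_0_iff zero_neq_one)
    moreover have "list_product g qs (pt t) = poly (?P qs) t" if "qs \<in> standard_lists m m k" for qs t
      using lp std(1) that by blast
    ultimately show "inj_on (list_product g) (standard_lists m m k)" "fun_vs.independent ?B"
      using independent_distinct_degrees[OF finite_standard_lists, of ?P m m k "list_product g" pt] by blast+
  qed
  have rel: "g (a, d) x * g (b, c) x = g (a, c) x * g (b, d) x - g (a, b) x * g (c, d) x"
    if "a < b" "b < c" "c < d" "d \<le> m" for a b c d x
  proof (cases "x \<in> X")
    case True
    then obtain u v where "bez_map m x = plucker m u v"
      unfolding X_def inverse_variety_eq[OF m] by blast
    then show ?thesis using True that
      by (simp add: g_def plucker_def mem_plucker_index algebra_simps)
  qed (simp add: g_def)
  have "fun_vs.dim (coord_ring_part (sym_index m) X k) = card (standard_lists m m k)"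
  proof (rule fun_vs.dim_unique)
    show "?B \<subseteq> coord_ring_part (sym_index m) X k"
      unfolding ring homogeneous_span_def using std by (auto intro!: fun_vs.span_base)
    show "coord_ring_part (sym_index m) X k \<subseteq> fun_vs.span ?B"
      unfolding ring homogeneous_span_def
      by (intro fun_vs.span_minimal fun_vs.subspace_span) (use straightening[of m g, OF rel] in auto)
    show "card ?B = card (standard_lists m m k)" by (rule card_image[OF inj])
  qed (rule indep)
  then show ?thesis by (simp add: hilbert_function_def X_def)
qed

section \<open>The Hilbert polynomial and the degree\<close>

text \<open>For \<open>m \<ge> 2\<close> its value at a natural number \<open>k\<close> is the
  Narayana number \<open>1 / (m + k) * C(m + k, m) * C(m + k, m - 1)\<close>.\<close>

definition narayana_poly :: "nat \<Rightarrow> rat poly" where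
  "narayana_poly m = smult (1 / (fact m * fact (m - 1)))
     ((\<Prod>i\<in>{1..m}. [:of_nat i, 1:]) * (\<Prod>i\<in>{2..m - 1}. [:of_nat i, 1:]))"

lemma narayana_poly_degree:
  assumes "2 \<le> m"
  shows "degree (narayana_poly m) = 2 * m - 2" "lead_coeff (narayana_poly m) = 1 / (fact m * fact (m - 1))"
proof -
  have d: "degree (\<Prod>i\<in>A. [:of_nat i, 1:] :: rat poly) = card A" for A :: "nat set"
    by (cases "finite A") (simp_all add: degree_prod_sum_eq)
  have l: "lead_coeff (\<Prod>i\<in>A. [:of_nat i, 1:] :: rat poly) = 1" for A :: "nat set"
    by (simp add: lead_coeff_prod)
  have nz: "(\<Prod>i\<in>A. [:of_nat i, 1:] :: rat poly) \<noteq> 0" for A :: "nat set"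
    using l[of A] by (metis leading_coeff_0_iff zero_neq_one)
  show "degree (narayana_poly m) = 2 * m - 2"
    unfolding narayana_poly_def using assms nz[of "{1..m}"] nz[of "{2..m - 1}"]
    by (simp only: degree_smult_eq degree_mult_eq[OF nz nz] d) simp
  show "lead_coeff (narayana_poly m) = 1 / (fact m * fact (m - 1))"
    unfolding narayana_poly_def by (simp only: lead_coeff_smult lead_coeff_mult l mult_1_right)
qed

lemma poly_narayana_poly:
  assumes m: "2 \<le> m"
  shows "poly (narayana_poly m) (of_nat (Suc k)) = of_nat (card (standard_lists m m (Suc k)))"
proof -
  obtain n where n: "m = Suc n" "0 < n" using m by (cases m) auto
  have p1: "(\<Prod>i\<in>{1..l}. of_nat i + of_nat j) = (fact (j + l) / fact j :: rat)" for l j :: nat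
    by (induction l) (simp_all add: algebra_simps)
  have p2: "(\<Prod>i\<in>{2..l}. of_nat i + of_nat j) = (fact (j + l) / fact (j + 1) :: rat)" if "1 \<le> l" for l j :: nat
  proof -
    have "{1..l} = insert 1 {2..l}" using that by auto
    then have "(\<Prod>i\<in>{1..l}. of_nat i + of_nat j) = (1 + of_nat j) * (\<Prod>i\<in>{2..l}. of_nat i + of_nat j :: rat)"
      by simp
    moreover have "1 + of_nat j \<noteq> (0 :: rat)" by (metis of_nat_Suc of_nat_neq_0)
    ultimately have "(\<Prod>i\<in>{2..l}. of_nat i + of_nat j) = (fact (j + l) / fact j / (1 + of_nat j) :: rat)"
      unfolding p1 by (simp add: eq_divide_eq)
    then show ?thesis by (simp add: mult.commute)
  qed
  have "rat_of_nat (card (standard_lists m m (Suc k)))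
      = rat_of_int (int (card (standard_lists m m (Suc k))))" by simp
  also have "\<dots> = of_nat ((m + k + 1) choose (k + 1)) * of_nat ((m + k) choose (k + 1))
    - of_nat ((m + k + 1) choose (k + 2)) * of_nat ((m + k) choose k)"
    by (subst card_standard_lists) simp_all
  also have "\<dots> = fact (n + k + 2) / (fact (k + 1) * fact (n + 1)) * (fact (n + k + 1) / (fact (k + 1) * fact n))
    - fact (n + k + 2) / (fact (k + 2) * fact n) * (fact (n + k + 1) / (fact k * fact (n + 1)))"
    using binomial_fact[of "k + 1" "m + k + 1", where ?'a = rat] binomial_fact[of "k + 1" "m + k", where ?'a = rat]
      binomial_fact[of "k + 2" "m + k + 1", where ?'a = rat] binomial_fact[of k "m + k", where ?'a = rat] n
    by (simp del: fact_Suc binomial_Suc_Suc)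
  \<comment> \<open>Over this common denominator the two terms carry the factors
    \<open>k + 2\<close> and \<open>k + 1\<close>, whose difference is 1.\<close>
  also have "\<dots> = fact (n + k + 2) * fact (n + k + 1) / (fact (n + 1) * fact n * fact (k + 1) * fact (k + 2))"
  proof -
    define u v w x y :: rat where "u = fact (n + k + 2)" and "v = fact (n + k + 1)" and "w = fact (n + 1)"
      and "x = fact n" and "y = fact k"
    define c where "c = rat_of_nat k"
    have k1: "fact (k + 1) = (c + 1) * y" and k2: "fact (k + 2) = (c + 2) * (c + 1) * y"
      by (simp_all add: c_def y_def algebra_simps)
    have "0 \<le> c" by (simp add: c_def)
    then have nz: "w \<noteq> 0" "x \<noteq> 0" "y \<noteq> 0" "c + 1 \<noteq> 0" "c + 2 \<noteq> 0"
      by (auto simp: w_def x_def y_def)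
    show ?thesis
      unfolding k1 k2 u_def[symmetric] v_def[symmetric] w_def[symmetric] x_def[symmetric] y_def[symmetric]
      using nz by (simp add: divide_simps) (simp add: algebra_simps)
  qed
  also have "\<dots> = poly (narayana_poly m) (of_nat (Suc k))"
  proof -
    have "poly (narayana_poly m) (of_nat (Suc k)) = 1 / (fact m * fact n) *
        ((\<Prod>i\<in>{1..m}. of_nat i + of_nat (Suc k)) * (\<Prod>i\<in>{2..n}. of_nat i + of_nat (Suc k)))"
    proof -
      have "m - 1 = n" using n by simp
      then show ?thesis by (simp add: narayana_poly_def poly_prod)
    qed
    also have "\<dots> = 1 / (fact m * fact n) * ((fact (Suc k + m) / fact (Suc k)) * (fact (Suc k + n) / fact (Suc k + 1)))"
      using n(2) by (subst p1, subst p2) auto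
    finally show ?thesis by (simp add: n add.commute del: fact_Suc)
  qed
  finally show ?thesis by simp
qed

text \<open>Polynomials that agree at infinitely many integers coincide, so any candidate determines
  the definite description in \<open>hilbert_polynomial\<close>.\<close>

lemma hilbert_polynomial_eqI:
  assumes "\<forall>\<^sub>F k in sequentially. poly P (of_nat k) = of_nat (hilbert_function I X k)"
  shows "hilbert_polynomial I X = P"
  unfolding hilbert_polynomial_def
proof (rule the_equality)
  fix Q :: "rat poly" assume "\<forall>\<^sub>F k in sequentially. poly Q (of_nat k) = of_nat (hilbert_function I X k)"
  with assms have "\<forall>\<^sub>F k in sequentially. poly (Q - P) (of_nat k) = 0"
    by eventually_elim simp
  then obtain N where N: "\<And>k. N \<le> k \<Longrightarrow> poly (Q - P) (of_nat k) = 0"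
    by (auto simp: eventually_sequentially)
  have "infinite (rat_of_nat ` {N..})"
    by (subst finite_image_iff) (auto simp: inj_on_def infinite_Ici)
  moreover have "rat_of_nat ` {N..} \<subseteq> {x. poly (Q - P) x = 0}" using N by auto
  ultimately have "infinite {x. poly (Q - P) x = 0}" using finite_subset by blast
  then have "Q - P = 0" using poly_roots_finite by blast
  then show "Q = P" by simp
qed (rule assms)

text \<open>Degree \<open>2 * m - 2\<close> and leading coefficient \<open>1 / (m! (m - 1)!)\<close>
  give \<open>(2 m - 2)! / (m! (m - 1)!)\<close>, which is the Catalan number.\<close>

lemma projective_degree_inverse_variety:
  assumes m: "2 \<le> m"
  shows "projective_degree (sym_index m) (inverse_variety m (hankel_mats m :: 'a::field_char_0 mat set))
    = 1 / of_nat m * of_nat ((2 * m - 2) choose (m - 1))"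
proof -
  let ?X = "inverse_variety m (hankel_mats m :: 'a mat set)"
  have "poly (narayana_poly m) (of_nat k) = of_nat (hilbert_function (sym_index m) ?X k)" if "1 \<le> k" for k
    using poly_narayana_poly[OF m, of "k - 1"] hilbert_function_inverse_variety[of m k, where ?'a = 'a] m that
    by simp
  then have "hilbert_polynomial (sym_index m) ?X = narayana_poly m"
    by (intro hilbert_polynomial_eqI eventually_sequentiallyI)
  then have "projective_degree (sym_index m) ?X = fact (2 * m - 2) / (fact m * fact (m - 1))"
    unfolding projective_degree_def Let_def
    by (simp only: narayana_poly_degree(2)[OF m]) (simp add: narayana_poly_degree(1)[OF m])
  also obtain n where n: "m = Suc n" using m by (cases m) auto
  have "fact (2 * m - 2) / (fact m * fact (m - 1)) = 1 / of_nat m * rat_of_nat ((2 * m - 2) choose (m - 1))"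
    by (simp add: n binomial_fact mult_2 field_simps)
  finally show ?thesis .
qed

text \<open>The entries are 0, 1 and -1, so one real matrix serves over both fields.\<close>

lemma of_real_bez_coeff: "complex_of_real (bez_coeff q s) = bez_coeff q s"
  by (simp add: bez_coeff_def split: prod.split)

theorem proposition7p2:
  fixes m :: nat
  assumes "m \<ge> 2"
  shows "(\<exists>T :: nat \<times> nat \<Rightarrow> nat \<times> nat \<Rightarrow> real.
            bij_betw (lin_map (sym_index m) (plucker_index m) T)
              (coord_space (sym_index m)) (coord_space (plucker_index m)) \<and>
            lin_map (sym_index m) (plucker_index m) T
              ` inverse_variety m (hankel_mats m :: real mat set) = grassmannian_cone m \<and>
            lin_map (sym_index m) (plucker_index m) (\<lambda>j i. complex_of_real (T j i))
              ` inverse_variety m (hankel_mats m :: complex mat set) = grassmannian_cone m)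
         \<and> projective_degree (sym_index m) (inverse_variety m (hankel_mats m :: complex mat set))
             = 1 / of_nat m * of_nat ((2 * m - 2) choose (m - 1))"
proof (intro conjI exI[of _ bez_coeff])
  have m: "0 < m" using assms by simp
  show "bij_betw (bez_map m) (coord_space (sym_index m)) (coord_space (plucker_index m) :: (_ \<Rightarrow> real) set)"
    by (rule bij_betw_bez_map)
  show "bez_map m ` inverse_variety m (hankel_mats m :: real mat set) = grassmannian_cone m"
    by (rule bez_map_inverse_variety[OF m])
  show "lin_map (sym_index m) (plucker_index m) (\<lambda>j i. complex_of_real (bez_coeff j i))
      ` inverse_variety m (hankel_mats m :: complex mat set) = grassmannian_cone m"
    unfolding of_real_bez_coeff by (rule bez_map_inverse_variety[OF m])
qed (rule projective_degree_inverse_variety[OF assms])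

end
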